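(* The calculus $\lambda j/{\tt obox}$ enjoys PSN: every $\lambda$-term that is $\beta$-strongly normalizing is strongly normalizing for $\to_{\lambda j/{\tt obox}}$.
   Context: $\lambda j$-terms are generated by $t,u::= x\mid \lambda x.t\mid t\,u\mid t[x/u]$; $\lambda x.t$ and $t[x/u]$ bind $x$ in $t$ (not in $u$), and terms are considered modulo $\alpha$-conversion. $\lambda$-terms are those without jumps. $\mathrm{fv}(t)$ is the set of free variables, $t\{x/u\}$ is capture-avoiding meta-level substitution, and $|t|_x$ is the number of free occurrences of $x$ in $t$. If $|t|_x=n\ge2$, $t_{[y]_x}$ denotes any term obtained from $t$ by replacing $k$ of the free occurrences of $x$ by a fresh variable $y$, for some $1\le k\le n-1$. ${\tt L}$ denotes a (possibly empty) list of jumps $[x_1/u_1]\dots[x_k/u_k]$. The rewriting rules, closed under all contexts, are: $({\tt dB})$ $(\lambda x.t){\tt L}\,u\to t[x/u]{\tt L}$ where no $x_i$ of ${\tt L}$ is free in $u$; $({\tt w})$ $t[x/u]\to t$ if $|t|_x=0$; $({\tt d})$ $t[x/u]\to t\{x/u\}$ if $|t|_x=1$; $({\tt c})$ $t[x/u]\to t_{[y]_x}[x/u][y/u]$ if $|t|_x\ge2$, $y$ fresh. $\to_{\lambda j}$ is the union of all four. The substitution equivalence $\equiv_{\tt obox}$ is the smallest equivalence closed under contexts containing: $t[x/s][y/v]\sim t[y/v][x/s]$ if $x\notin\mathrm{fv}(v)$ and $y\notin\mathrm{fv}(s)$; $\lambda y.(t[x/s])\sim(\lambda y.t)[x/s]$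 if $y\notin\mathrm{fv}(s)$; $t[x/s]\,v\sim(t\,v)[x/s]$ if $x\notin\mathrm{fv}(v)$; $(t\,v)[x/u]\sim t\,(v[x/u])$ if $x\notin\mathrm{fv}(t)$ and $x\in\mathrm{fv}(v)$; $t[y/v][x/u]\sim t[y/v[x/u]]$ if $x\notin\mathrm{fv}(t)$ and $x\in\mathrm{fv}(v)$. $t\to_{\lambda j/{\tt obox}}u$ iff $t\equiv_{\tt obox}t'\to_{\lambda j}u'\equiv_{\tt obox}u$ for some $t',u'$. $\beta$-reduction is the contextual closure of $(\lambda x.t)u\to t\{x/u\}$. *)

theory Defs
  imports Main
begin

(* lambda-j terms in de Bruijn representation (terms modulo alpha-conversion).
   Lam t binds index 0 in t; Sub t u is the jump t[x/u], binding index 0 in t (not in u). *)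
datatype trm = Var nat | Lam trm | App trm trm | Sub trm trm

definition ext :: "(nat \<Rightarrow> nat) \<Rightarrow> nat \<Rightarrow> nat" where
  "ext f i = (case i of 0 \<Rightarrow> 0 | Suc j \<Rightarrow> Suc (f j))"

fun ren :: "(nat \<Rightarrow> nat) \<Rightarrow> trm \<Rightarrow> trm" where
  "ren f (Var i) = Var (f i)"
| "ren f (Lam t) = Lam (ren (ext f) t)"
| "ren f (App t u) = App (ren f t) (ren f u)"
| "ren f (Sub t u) = Sub (ren (ext f) t) (ren f u)"

definition lift :: "trm \<Rightarrow> trm" where
  "lift t = ren Suc t"

definition liftn :: "nat \<Rightarrow> trm \<Rightarrow> trm" where
  "liftn k t = ren (\<lambda>i. i + k) t"

(* remove index 0 (only meaningful when it does not occur free) *)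
definition lower :: "trm \<Rightarrow> trm" where
  "lower t = ren (\<lambda>i. i - 1) t"

definition swap01 :: "nat \<Rightarrow> nat" where
  "swap01 i = (if i = 0 then 1 else if i = 1 then 0 else i)"

fun occ :: "nat \<Rightarrow> trm \<Rightarrow> nat" where
  "occ k (Var i) = (if i = k then 1 else 0)"
| "occ k (Lam t) = occ (Suc k) t"
| "occ k (App t u) = occ k t + occ k u"
| "occ k (Sub t u) = occ (Suc k) t + occ k u"

fun subst :: "trm \<Rightarrow> nat \<Rightarrow> trm \<Rightarrow> trm" where
  "subst (Var i) k s = (if k < i then Var (i - 1) else if i = k then s else Var i)"
| "subst (Lam t) k s = Lam (subst t (Suc k) (lift s))"
| "subst (App t u) k s = App (subst t k s) (subst u k s)"
| "subst (Sub t u) k s = Sub (subst t (Suc k) (lift s)) (subst u k s)"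

fun is_lambda :: "trm \<Rightarrow> bool" where
  "is_lambda (Var i) = True"
| "is_lambda (Lam t) = is_lambda t"
| "is_lambda (App t u) = (is_lambda t \<and> is_lambda u)"
| "is_lambda (Sub t u) = False"

(* t L, with L = [x1/u1]...[xk/uk] given as the list [u1,...,uk] (u1 innermost) *)
fun wrap :: "trm list \<Rightarrow> trm \<Rightarrow> trm" where
  "wrap [] t = t"
| "wrap (u # us) t = wrap us (Sub t u)"

inductive rename_some :: "nat \<Rightarrow> nat \<Rightarrow> trm \<Rightarrow> trm \<Rightarrow> bool" where
  rs_keep: "rename_some x y (Var i) (Var i)"
| rs_repl: "rename_some x y (Var x) (Var y)"
| rs_lam: "rename_some (Suc x) (Suc y) t t' \<Longrightarrow> rename_some x y (Lam t) (Lam t')"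
| rs_app: "rename_some x y t t' \<Longrightarrow> rename_some x y u u' \<Longrightarrow> rename_some x y (App t u) (App t' u')"
| rs_sub: "rename_some (Suc x) (Suc y) t t' \<Longrightarrow> rename_some x y u u' \<Longrightarrow> rename_some x y (Sub t u) (Sub t' u')"

inductive beta :: "trm \<Rightarrow> trm \<Rightarrow> bool" where
  b_beta: "beta (App (Lam t) u) (subst t 0 u)"
| b_lam: "beta t t' \<Longrightarrow> beta (Lam t) (Lam t')"
| b_appl: "beta t t' \<Longrightarrow> beta (App t u) (App t' u)"
| b_appr: "beta u u' \<Longrightarrow> beta (App t u) (App t u')"

inductive lj :: "trm \<Rightarrow> trm \<Rightarrow> bool" where
  lj_dB: "lj (App (wrap L (Lam t)) u) (wrap L (Sub t (liftn (length L) u)))"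
| lj_w: "occ 0 t = 0 \<Longrightarrow> lj (Sub t u) (subst t 0 u)"
| lj_d: "occ 0 t = 1 \<Longrightarrow> lj (Sub t u) (subst t 0 u)"
| lj_c: "occ 0 t \<ge> 2 \<Longrightarrow> rename_some 0 1 (ren (ext Suc) t) t'' \<Longrightarrow>
         occ 0 t'' \<ge> 1 \<Longrightarrow> occ 1 t'' \<ge> 1 \<Longrightarrow>
         lj (Sub t u) (Sub (Sub t'' (lift u)) u)"
| lj_lam: "lj t t' \<Longrightarrow> lj (Lam t) (Lam t')"
| lj_appl: "lj t t' \<Longrightarrow> lj (App t u) (App t' u)"
| lj_appr: "lj u u' \<Longrightarrow> lj (App t u) (App t u')"
| lj_subl: "lj t t' \<Longrightarrow> lj (Sub t u) (Sub t' u)"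
| lj_subr: "lj u u' \<Longrightarrow> lj (Sub t u) (Sub t u')"

inductive obox_ax :: "trm \<Rightarrow> trm \<Rightarrow> bool" where
  (* t[x/s][y/v] ~ t[y/v][x/s], y not free in s *)
  ax_perm: "occ 0 s = 0 \<Longrightarrow>
     obox_ax (Sub (Sub t s) v) (Sub (Sub (ren swap01 t) (lift v)) (lower s))"
  (* \<lambda>y.(t[x/s]) ~ (\<lambda>y.t)[x/s], y not free in s *)
| ax_lam: "occ 0 s = 0 \<Longrightarrow>
     obox_ax (Lam (Sub t s)) (Sub (Lam (ren swap01 t)) (lower s))"
  (* t[x/s] v ~ (t v)[x/s] *)
| ax_appl: "obox_ax (App (Sub t s) v) (Sub (App t (lift v)) s)"
  (* (t v)[x/u] ~ t (v[x/u]), x not free in t, x free in v *)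
| ax_appr: "occ 0 t = 0 \<Longrightarrow> occ 0 v > 0 \<Longrightarrow>
     obox_ax (Sub (App t v) u) (App (lower t) (Sub v u))"
  (* t[y/v][x/u] ~ t[y/v[x/u]], x not free in t, x free in v *)
| ax_box: "occ 1 t = 0 \<Longrightarrow> occ 0 v > 0 \<Longrightarrow>
     obox_ax (Sub (Sub t v) u) (Sub (ren (\<lambda>i. if i = 0 then 0 else i - 1) t) (Sub v u))"

inductive obox_step :: "trm \<Rightarrow> trm \<Rightarrow> bool" where
  os_ax: "obox_ax t u \<Longrightarrow> obox_step t u"
| os_lam: "obox_step t t' \<Longrightarrow> obox_step (Lam t) (Lam t')"
| os_appl: "obox_step t t' \<Longrightarrow> obox_step (App t u) (App t' u)"
| os_appr: "obox_step u u' \<Longrightarrow> obox_step (App t u) (App t u')"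
| os_subl: "obox_step t t' \<Longrightarrow> obox_step (Sub t u) (Sub t' u)"
| os_subr: "obox_step u u' \<Longrightarrow> obox_step (Sub t u) (Sub t u')"

definition obox_eq :: "trm \<Rightarrow> trm \<Rightarrow> bool" where
  "obox_eq = (\<lambda>t u. obox_step t u \<or> obox_step u t)\<^sup>*\<^sup>*"

definition lj_obox :: "trm \<Rightarrow> trm \<Rightarrow> bool" where
  "lj_obox t u = (\<exists>t' u'. obox_eq t t' \<and> lj t' u' \<and> obox_eq u' u)"

definition SN :: "(trm \<Rightarrow> trm \<Rightarrow> bool) \<Rightarrow> trm \<Rightarrow> bool" where
  "SN R t = Wellfounded.accp (\<lambda>y x. R x y) t"

end

(* Non-idempotent intersection types with weakening. A derivation types every subterm at least
   once, so the number of its application rules strictly drops at a dB step, does not increase at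
   the steps w, d, c, and is invariant under the substitution equivalence: a jump whose variable
   occurs in v can move in and out of v because its resources split over the copies of v. The steps
   w, d, c terminate on their own: the weight in which a jump t[x/u] counts its body u once per
   potential occurrence of x is invariant under the equivalence, drops at w and d, is kept by c,
   and bounds the number of jumps, which c increases. Hence typable terms are strongly normalizing.
   Finally beta-SN lambda-terms are typable, by subject expansion along weak head reduction. *)
theory Submission
  imports Defs "HOL-Library.Multiset" "HOL-Library.Function_Algebras"
begin

section \<open>Renamings\<close>

text \<open>Two demands pull against each other. Strong normalization needs a type for every
  argument, including the content of a void jump, since a dB step inside it must lower the count;
  hence the multiset of an application or a jump is never empty. Substitution, by contrast, asks for
  no derivation of \<open>u\<close> when the variable is absent, so it is described by a second rule
  whose multiset may be empty. The two rules agree as soon as the variable occurs, and this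
  occurrence is a side condition of the two axioms that move a jump in and out of an argument or of
  the content of another jump. The order is lexicographic with the typing count in front, because a
  dB step creates a jump and may raise the weight.\<close>

lemma ext_simps [simp]: "ext f 0 = 0" "ext f (Suc i) = Suc (f i)"
  by (simp_all add: ext_def)

lemma ext_eq_0_iff [simp]: "ext f i = 0 \<longleftrightarrow> i = 0" "0 = ext f i \<longleftrightarrow> i = 0"
  by (cases i; simp)+

lemma ext_ext: "ext g (ext f i) = ext (\<lambda>i. g (f i)) i"
  by (cases i) simp_all

lemma ren_ren: "ren g (ren f t) = ren (\<lambda>i. g (f i)) t"
  by (induction t arbitrary: f g) (simp_all add: ext_ext)

lemma ren_id_on: "(\<And>i. occ i t > 0 \<Longrightarrow> f i = i) \<Longrightarrow> ren f t = t"
proof (induction t arbitrary: f)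
  case (Lam t)
  have "ren (ext f) t = t"
    by (rule Lam.IH) (use Lam.prems in \<open>auto simp: ext_def split: nat.splits\<close>)
  then show ?case by simp
next
  case (Sub t u)
  have "ren (ext f) t = t"
    by (rule Sub.IH) (use Sub.prems in \<open>auto simp: ext_def split: nat.splits\<close>)
  moreover have "ren f u = u" using Sub.IH(2) Sub.prems by simp
  ultimately show ?case by simp
qed (auto split: if_splits)

lemma ren_retract: "(\<And>i. g (f i) = i) \<Longrightarrow> ren g (ren f t) = t"
  by (simp add: ren_ren ren_id_on)

lemma swap01_swap01 [simp]: "swap01 (swap01 i) = i"
  by (simp add: swap01_def)

lemma ren_swap01_swap01 [simp]: "ren swap01 (ren swap01 t) = t"
  by (simp add: ren_retract)

lemma lift_lower:
  assumes "occ 0 t = 0" shows "lift (lower t) = t"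
proof -
  have "Suc (i - 1) = i" if "occ i t > 0" for i
    using that assms by (cases i) auto
  then show ?thesis unfolding lift_def lower_def ren_ren by (rule ren_id_on)
qed

lemma lower_lift [simp]: "lower (lift t) = t"
  unfolding lift_def lower_def ren_ren by (simp add: ren_id_on)

lemma occ_ren_notin: "(\<And>i. f i \<noteq> k) \<Longrightarrow> occ k (ren f t) = 0"
proof (induction t arbitrary: f k)
  case (Lam t)
  have "occ (Suc k) (ren (ext f) t) = 0"
    by (rule Lam.IH) (use Lam.prems in \<open>auto simp: ext_def split: nat.splits\<close>)
  then show ?case by simp
next
  case (Sub t u)
  have "occ (Suc k) (ren (ext f) t) = 0"
    by (rule Sub.IH(1)) (use Sub.prems in \<open>auto simp: ext_def split: nat.splits\<close>)
  then show ?case using Sub.IH(2)[of f k] Sub.prems by simp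
qed auto

text \<open>\<open>wrap\<close> recurses from the innermost jump, whereas a typing derivation starts
  with the outermost one; this equation exposes the latter for reverse induction on the
  list.\<close>

lemma wrap_snoc [simp]: "wrap (L @ [v]) t = Sub (wrap L t) v"
  by (induction L arbitrary: t) simp_all


section \<open>Termination of the jump rules\<close>

text \<open>Potential multiplicity: the number of free occurrences of \<open>k\<close> once every non-void jump is
  executed, a void jump counting its content once.\<close>
fun pmult :: "nat \<Rightarrow> trm \<Rightarrow> nat" where
  "pmult k (Var i) = (if i = k then 1 else 0)"
| "pmult k (Lam t) = pmult (Suc k) t"
| "pmult k (App t u) = pmult k t + pmult k u"
| "pmult k (Sub t u) = pmult (Suc k) t + max 1 (pmult 0 t) * pmult k u"

text \<open>A jump weighs one more than its content, counted once per potential copy. The multiplier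
  makes contraction neutral, since copies are only shared out; the extra unit makes every executed
  jump a strict loss; the \<open>max\<close> gives a void jump a positive weight to lose when it is
  erased.\<close>

fun jweight :: "trm \<Rightarrow> nat" where
  "jweight (Var i) = 0"
| "jweight (Lam t) = jweight t"
| "jweight (App t u) = jweight t + jweight u"
| "jweight (Sub t u) = jweight t + max 1 (pmult 0 t) * Suc (jweight u)"

fun jumps :: "trm \<Rightarrow> nat" where
  "jumps (Var i) = 0"
| "jumps (Lam t) = jumps t"
| "jumps (App t u) = jumps t + jumps u"
| "jumps (Sub t u) = Suc (jumps t + jumps u)"

lemma pmult_pos_iff: "pmult k t > 0 \<longleftrightarrow> occ k t > 0"
  by (induction t arbitrary: k) auto

lemma pmult_eq_0_iff: "pmult k t = 0 \<longleftrightarrow> occ k t = 0"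
  using pmult_pos_iff[of k t] by linarith

lemma jumps_le_jweight: "jumps t \<le> jweight t"
proof (induction t)
  case (Sub t u)
  have "Suc (jweight u) \<le> max 1 (pmult 0 t) * Suc (jweight u)"
    using mult_le_mono1[of 1 "max 1 (pmult 0 t)" "Suc (jweight u)"] by simp
  with Sub show ?case by simp
qed simp_all

text \<open>Only the fibre of \<open>f\<close> over \<open>f k\<close> has to be a singleton. Under
  a binder \<open>ext f\<close> satisfies this at index 0 whatever \<open>f\<close> is, so the
  multipliers of jumps, and with them \<open>jweight\<close>, survive arbitrary renamings.\<close>

lemma pmult_ren: "(\<And>i. f i = f k \<Longrightarrow> i = k) \<Longrightarrow> pmult (f k) (ren f t) = pmult k t"
proof (induction t arbitrary: f k)
  case (Lam t)
  have "pmult (ext f (Suc k)) (ren (ext f) t) = pmult (Suc k) t"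
    by (rule Lam.IH) (use Lam.prems in \<open>auto simp: ext_def split: nat.splits\<close>)
  then show ?case by simp
next
  case (Sub t u)
  have "pmult (ext f (Suc k)) (ren (ext f) t) = pmult (Suc k) t"
    by (rule Sub.IH(1)) (use Sub.prems in \<open>auto simp: ext_def split: nat.splits\<close>)
  moreover have "pmult (ext f 0) (ren (ext f) t) = pmult 0 t"
    by (rule Sub.IH(1)) simp
  ultimately show ?case using Sub.IH(2)[of f k] Sub.prems by simp
qed auto

lemma pmult_ren_ext_0 [simp]: "pmult 0 (ren (ext f) t) = pmult 0 t"
  using pmult_ren[of "ext f" 0 t] by simp

lemma pmult_ren_notin: "(\<And>i. f i \<noteq> k) \<Longrightarrow> pmult k (ren f t) = 0"
  by (simp add: pmult_eq_0_iff occ_ren_notin)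

lemma jweight_ren [simp]: "jweight (ren f t) = jweight t"
  by (induction t arbitrary: f) simp_all

lemma jumps_ren [simp]: "jumps (ren f t) = jumps t"
  by (induction t arbitrary: f) simp_all

lemma pmult_lift [simp]: "pmult (Suc k) (lift t) = pmult k t" "pmult 0 (lift t) = 0"
  using pmult_ren[of Suc k t] by (simp_all add: lift_def pmult_ren_notin)

lemma jweight_lift [simp]: "jweight (lift t) = jweight t"
  and jumps_lift [simp]: "jumps (lift t) = jumps t"
  by (simp_all add: lift_def)

lemma pmult_swap01: "pmult k (ren swap01 t) = pmult (swap01 k) t"
  using pmult_ren[of swap01 "swap01 k" t] by (metis swap01_swap01)

lemma pmult_swap01_simps [simp]:
  "pmult 0 (ren swap01 t) = pmult (Suc 0) t"
  "pmult (Suc 0) (ren swap01 t) = pmult 0 t"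
  "pmult (Suc (Suc k)) (ren swap01 t) = pmult (Suc (Suc k)) t"
  by (simp_all add: pmult_swap01 swap01_def)

text \<open>The multiplier of a jump inside \<open>t\<close> does not change, because the lifted
  \<open>u\<close> does not contain index 0; so copies of \<open>u\<close> scale exactly like the
  occurrences they replace.\<close>

lemma pmult_subst:
  "pmult j (subst t k u) = pmult (if j < k then j else Suc j) t + pmult k t * pmult j u"
proof (induction t arbitrary: j k u)
  case (Var i)
  show ?case by (cases i) auto
next
  case (Sub t1 t2)
  show ?case by (simp add: Sub algebra_simps)
qed (simp_all add: algebra_simps)

lemma jweight_subst: "jweight (subst t k u) = jweight t + pmult k t * jweight u"
  by (induction t arbitrary: k u) (simp_all add: pmult_subst algebra_simps)

lemma rename_some_pmult_other:
  "rename_some x y t t' \<Longrightarrow> z \<noteq> x \<Longrightarrow> z \<noteq> y \<Longrightarrow> pmult z t' = pmult z t"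
  by (induction arbitrary: z rule: rename_some.induct) auto

lemma rename_some_pmult:
  "rename_some x y t t' \<Longrightarrow> x \<noteq> y \<Longrightarrow> pmult x t' + pmult y t' = pmult x t + pmult y t"
proof (induction rule: rename_some.induct)
  case (rs_sub x y t t' u u')
  have 0: "pmult 0 t' = pmult 0 t"
    using rename_some_pmult_other[OF rs_sub.hyps(1)] by simp
  have "pmult x (Sub t' u') + pmult y (Sub t' u')
      = (pmult (Suc x) t' + pmult (Suc y) t') + max 1 (pmult 0 t) * (pmult x u' + pmult y u')"
    unfolding pmult.simps 0 by (simp add: algebra_simps)
  also have "\<dots> = pmult x (Sub t u) + pmult y (Sub t u)"
    using rs_sub.IH rs_sub.prems by (simp add: algebra_simps)
  finally show ?case .
qed simp_all

lemma rename_some_jweight: "rename_some x y t t' \<Longrightarrow> jweight t' = jweight t"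
  by (induction rule: rename_some.induct) (simp_all add: rename_some_pmult_other)

lemma rename_some_jumps: "rename_some x y t t' \<Longrightarrow> jumps t' = jumps t"
  by (induction rule: rename_some.induct) simp_all

text \<open>The condition on multiplicities makes the comparison closed under contexts.\<close>
definition jless :: "trm \<Rightarrow> trm \<Rightarrow> bool" where
  "jless t' t \<longleftrightarrow> (\<forall>k. pmult k t' \<le> pmult k t) \<and>
     (jweight t' < jweight t \<or> jweight t' = jweight t \<and> jumps t < jumps t')"

lemma jless_Lam: "jless t' t \<Longrightarrow> jless (Lam t') (Lam t)"
  and jless_AppL: "jless t' t \<Longrightarrow> jless (App t' u) (App t u)"
  and jless_AppR: "jless t' t \<Longrightarrow> jless (App u t') (App u t)"
  by (auto simp: jless_def)

lemma jless_SubL: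
  assumes "jless t' t" shows "jless (Sub t' u) (Sub t u)"
proof -
  have *: "max 1 (pmult 0 t') \<le> max 1 (pmult 0 t)"
    using assms unfolding jless_def by (meson max.mono order_refl)
  have "pmult k (Sub t' u) \<le> pmult k (Sub t u)" for k
    using assms * unfolding jless_def pmult.simps by (intro add_mono mult_le_mono1) auto
  moreover have "max 1 (pmult 0 t') * Suc (jweight u) \<le> max 1 (pmult 0 t) * Suc (jweight u)"
    using * by (rule mult_le_mono1)
  ultimately show ?thesis using assms by (auto simp: jless_def simp del: pmult.simps)
qed

lemma jless_SubR:
  assumes "jless u' u" shows "jless (Sub t u') (Sub t u)"
proof -
  have "pmult k (Sub t u') \<le> pmult k (Sub t u)" for k
    using assms unfolding jless_def pmult.simps by (intro add_mono mult_le_mono2) auto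
  moreover have "max 1 (pmult 0 t) * Suc (jweight u') < max 1 (pmult 0 t) * Suc (jweight u)"
    if "jweight u' < jweight u"
    using that by (intro mult_less_mono2) auto
  ultimately show ?thesis using assms by (auto simp: jless_def simp del: pmult.simps mult_Suc_right mult_less_cancel1)
qed

text \<open>One comparison serves both w and d: \<open>max 1 (pmult 0 t)\<close> copies of
  \<open>Suc (jweight u)\<close> give way to \<open>pmult 0 t\<close> copies of
  \<open>jweight u\<close>, so at least the unit of the jump is lost.\<close>

lemma jless_subst: "jless (subst t 0 u) (Sub t u)"
proof -
  have le: "pmult 0 t * a \<le> max 1 (pmult 0 t) * a" for a
    by (rule mult_le_mono1) simp
  moreover have "pmult 0 t * a < max 1 (pmult 0 t) * Suc a" for a
    by (rule le_less_trans[OF le]) simp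
  ultimately show ?thesis
    by (simp add: jless_def pmult_subst jweight_subst del: mult_Suc_right mult_le_cancel2)
qed

text \<open>The occurrences are shared out between two variables that both occur, so both
  multipliers are positive, \<open>max 1\<close> acts as the identity, and they add up to the old
  multiplier. Multiplicities and weight are therefore unchanged, and the growth of
  \<open>jumps\<close> alone is the progress.\<close>

lemma jless_contract:
  assumes "rename_some 0 1 (ren (ext Suc) t) t'" "occ 0 t' \<ge> 1" "occ 1 t' \<ge> 1"
  shows "jless (Sub (Sub t' (lift u)) u) (Sub t u)"
proof -
  have 0: "pmult 0 t' + pmult (Suc 0) t' = pmult 0 t"
    using rename_some_pmult[OF assms(1)] pmult_ren_notin[of "ext Suc" "Suc 0" t]
    by (simp add: ext_def split: nat.splits)
  have pos: "pmult 0 t' > 0" "pmult (Suc 0) t' > 0" using assms by (simp_all add: pmult_pos_iff)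
  then have m: "max 1 (pmult 0 t') = pmult 0 t'" "max 1 (pmult (Suc 0) t') = pmult (Suc 0) t'"
    "max 1 (pmult 0 t) = pmult 0 t' + pmult (Suc 0) t'" using 0 by auto
  have k: "pmult (Suc (Suc k)) t' = pmult (Suc k) t" for k
    using rename_some_pmult_other[OF assms(1), of "Suc (Suc k)"] pmult_ren[of "ext Suc" "Suc k" t]
    by (simp add: ext_def split: nat.splits)
  have "pmult k (Sub (Sub t' (lift u)) u) = pmult k (Sub t u)" for k
    by (simp only: pmult.simps pmult_lift k m mult_0_right add_0_right add_mult_distrib add.assoc)
  moreover have "jweight (Sub (Sub t' (lift u)) u) = jweight (Sub t u)"
    using rename_some_jweight[OF assms(1)]
    by (simp only: jweight.simps pmult.simps jweight_lift jweight_ren pmult_lift m mult_0_right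
        add_0_right add_mult_distrib add.assoc)
  moreover have "jumps t' = jumps t"
    using rename_some_jumps[OF assms(1)] by simp
  ultimately show ?thesis
    unfolding jless_def by (simp del: pmult.simps jweight.simps)
qed


section \<open>Non-idempotent intersection types with weakening\<close>

datatype ty = Atom | Arr "ty multiset" ty

type_synonym ctx = "nat \<Rightarrow> ty multiset"

abbreviation cons :: "ty multiset \<Rightarrow> ctx \<Rightarrow> ctx" (infixr "\<cdot>" 68) where
  "M \<cdot> \<Gamma> \<equiv> case_nat M \<Gamma>"

lemma cons_plus: "(M + N) \<cdot> (\<Gamma> + \<Delta>) = M \<cdot> \<Gamma> + N \<cdot> \<Delta>"
  by (rule HOL.ext) (simp add: plus_fun_def split: nat.splits)

lemma cons_eta: "\<Gamma> 0 \<cdot> (\<lambda>i. \<Gamma> (Suc i)) = \<Gamma>"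
  by (rule HOL.ext) (simp split: nat.splits)

lemma cons_eq_plusE:
  assumes "M \<cdot> \<Gamma> = G + H"
  obtains M1 M2 \<Gamma>1 \<Gamma>2 where "G = M1 \<cdot> \<Gamma>1" "H = M2 \<cdot> \<Gamma>2" "M = M1 + M2" "\<Gamma> = \<Gamma>1 + \<Gamma>2"
proof
  show "G = G 0 \<cdot> (\<lambda>i. G (Suc i))" "H = H 0 \<cdot> (\<lambda>i. H (Suc i))" by (simp_all add: cons_eta)
  show "M = G 0 + H 0" using fun_cong[OF assms, of 0] by simp
  show "\<Gamma> = (\<lambda>i. G (Suc i)) + (\<lambda>i. H (Suc i))"
    using fun_cong[OF assms, of "Suc _"] by (auto simp: plus_fun_def)
qed

text \<open>A family of derivations, one per element of the multiset, with contexts and bounds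
  added. The parameter \<open>P\<close> lets \<open>typed\<close> recurse structurally through
  \<open>many (typed u)\<close>. The empty family accepts any context and any bound, which provides
  slack for weakening.\<close>

inductive many :: "(ctx \<Rightarrow> nat \<Rightarrow> ty \<Rightarrow> bool) \<Rightarrow> ctx \<Rightarrow> nat \<Rightarrow> ty multiset \<Rightarrow> bool" for P where
  many_empty: "many P \<Gamma> n {#}"
| many_add: "P \<Gamma> n A \<Longrightarrow> many P \<Delta> m M \<Longrightarrow> many P (\<Gamma> + \<Delta>) (n + m) (add_mset A M)"

text \<open>In \<open>typed t \<Gamma> n A\<close> the number \<open>n\<close> bounds the number of application rules in a derivation
  of \<open>\<Gamma> \<turnstile> t : A\<close>. Contexts may be weakened at variables, so an erased argument can always be
  charged to a non-empty multiset and needs no rule of its own.\<close>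
primrec typed :: "trm \<Rightarrow> ctx \<Rightarrow> nat \<Rightarrow> ty \<Rightarrow> bool" where
  "typed (Var i) = (\<lambda>\<Gamma> n A. A \<in># \<Gamma> i)"
| "typed (Lam t) = (\<lambda>\<Gamma> n A. \<exists>M B. A = Arr M B \<and> typed t (M \<cdot> \<Gamma>) n B)"
| "typed (App t u) = (\<lambda>\<Gamma> n A. \<exists>\<Gamma>1 \<Gamma>2 n1 n2 M. \<Gamma> = \<Gamma>1 + \<Gamma>2 \<and> n = Suc (n1 + n2) \<and> M \<noteq> {#} \<and>
     typed t \<Gamma>1 n1 (Arr M A) \<and> many (typed u) \<Gamma>2 n2 M)"
| "typed (Sub t u) = (\<lambda>\<Gamma> n A. \<exists>\<Gamma>1 \<Gamma>2 n1 n2 M. \<Gamma> = \<Gamma>1 + \<Gamma>2 \<and> n = n1 + n2 \<and> M \<noteq> {#} \<and>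
     typed t (M \<cdot> \<Gamma>1) n1 A \<and> many (typed u) \<Gamma>2 n2 M)"

lemma typed_AppI:
  "typed t \<Gamma> n (Arr M A) \<Longrightarrow> many (typed u) \<Delta> m M \<Longrightarrow> M \<noteq> {#} \<Longrightarrow>
   typed (App t u) (\<Gamma> + \<Delta>) (Suc (n + m)) A"
  unfolding typed.simps by blast

lemma typed_SubI:
  "typed t (M \<cdot> \<Gamma>) n A \<Longrightarrow> many (typed u) \<Delta> m M \<Longrightarrow> M \<noteq> {#} \<Longrightarrow>
   typed (Sub t u) (\<Gamma> + \<Delta>) (n + m) A"
  unfolding typed.simps by blast

lemma typed_AppE:
  assumes "typed (App t u) \<Gamma> n A"
  obtains \<Gamma>1 \<Gamma>2 n1 n2 M where "\<Gamma> = \<Gamma>1 + \<Gamma>2" "n = Suc (n1 + n2)" "M \<noteq> {#}"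
    "typed t \<Gamma>1 n1 (Arr M A)" "many (typed u) \<Gamma>2 n2 M"
  using assms by auto

lemma typed_SubE:
  assumes "typed (Sub t u) \<Gamma> n A"
  obtains \<Gamma>1 \<Gamma>2 n1 n2 M where "\<Gamma> = \<Gamma>1 + \<Gamma>2" "n = n1 + n2" "M \<noteq> {#}"
    "typed t (M \<cdot> \<Gamma>1) n1 A" "many (typed u) \<Gamma>2 n2 M"
  using assms by auto

declare typed.simps(3,4) [simp del]

section \<open>Weakening of contexts and bounds\<close>

lemma many_mono:
  assumes "many P \<Gamma> n M" "\<And>\<Gamma> n A. P \<Gamma> n A \<Longrightarrow> Q \<Gamma> n A"
  shows "many Q \<Gamma> n M"
  using assms by (induction rule: many.induct) (auto intro: many.intros)

lemma many_map:
  assumes "many P \<Gamma> n M" "\<And>\<Gamma> n A. P \<Gamma> n A \<Longrightarrow> Q (h \<Gamma>) n A" "\<And>\<Gamma> \<Delta>. h (\<Gamma> + \<Delta>) = h \<Gamma> + h \<Delta>"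
  shows "many Q (h \<Gamma>) n M"
  using assms by (induction rule: many.induct) (auto intro: many.intros)

lemma many_nonempty:
  assumes "many P \<Gamma> n M" "\<And>\<Gamma> n A. P \<Gamma> n A \<Longrightarrow> \<Gamma> i \<noteq> {#}" "M \<noteq> {#}"
  shows "\<Gamma> i \<noteq> {#}"
  using assms by (induction rule: many.induct) auto

text \<open>Weakening below a rule that splits its context has to split the larger context
  accordingly; \<open>V\<close> and \<open>V'\<close> stand for the free variables of the two
  premises.\<close>

lemma split_above:
  assumes "\<forall>i \<in> V \<union> V'. (\<Gamma> + \<Delta>) i \<subseteq># (\<Theta> :: ctx) i"
  shows "\<exists>\<Gamma>' \<Delta>'. \<Theta> = \<Gamma>' + \<Delta>' \<and> (\<forall>i\<in>V. \<Gamma> i \<subseteq># \<Gamma>' i) \<and> (\<forall>i\<in>V'. \<Delta> i \<subseteq># \<Delta>' i)"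
proof (intro exI conjI ballI)
  \<comment> \<open>Intersecting with \<open>\<Theta>\<close> keeps the sum equal to
    \<open>\<Theta>\<close> also at indices outside \<open>V \<union> V'\<close>, where nothing
    relates \<open>\<Gamma>\<close> and \<open>\<Theta>\<close>.\<close>
  define G where "G i = \<Gamma> i \<inter># \<Theta> i" for i
  show "\<Theta> = G + (\<lambda>i. \<Theta> i - G i)"
    by (rule HOL.ext) (auto simp: G_def multiset_eq_iff min_def)
  have *: "G i = \<Gamma> i" if "i \<in> V \<union> V'" for i
    using bspec[OF assms that] unfolding G_def plus_fun_apply
    by (meson mset_subset_eq_add_left subset_mset.inf.absorb1 subset_mset.order_trans)
  then show "\<Gamma> i \<subseteq># G i" if "i \<in> V" for i using that by simp
  show "\<Delta> i \<subseteq># \<Theta> i - G i" if "i \<in> V'" for i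
  proof -
    have "count (\<Delta> i) a \<le> count (\<Theta> i) a - count (\<Gamma> i) a" for a
      using mset_subset_eq_count[OF bspec[OF assms, of i], of a] that by simp
    then show ?thesis using * that by (simp add: subseteq_mset_def)
  qed
qed

lemma many_weaken_on:
  assumes "many P \<Gamma> n M" "n \<le> n'" "\<And>i. i \<in> V \<Longrightarrow> \<Gamma> i \<subseteq># \<Gamma>' i"
    and "\<And>\<Gamma> n A \<Gamma>'. P \<Gamma> n A \<Longrightarrow> (\<And>i. i \<in> V \<Longrightarrow> \<Gamma> i \<subseteq># \<Gamma>' i) \<Longrightarrow> P \<Gamma>' n A"
  shows "many P \<Gamma>' n' M"
  using assms(1-3)
proof (induction arbitrary: \<Gamma>' n' rule: many.induct)
  case (many_add \<Gamma> n A \<Delta> m M)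
  from many_add.prems(2) have "\<forall>i \<in> V \<union> V. (\<Gamma> + \<Delta>) i \<subseteq># \<Gamma>' i" by simp
  from split_above[OF this] obtain G H where "\<Gamma>' = G + H"
    "\<And>i. i \<in> V \<Longrightarrow> \<Gamma> i \<subseteq># G i" "\<And>i. i \<in> V \<Longrightarrow> \<Delta> i \<subseteq># H i" by auto
  then have "many P \<Gamma>' (n + (n' - n)) (add_mset A M)"
    using many_add.IH[of "n' - n" H] many.many_add[of P G n A H "n' - n" M]
      assms(4)[OF many_add.hyps(1), of G] many_add.prems(1) by fastforce
  then show ?case using many_add.prems(1) by simp
qed (rule many_empty)

text \<open>Only the free variables constrain the new context, so this is strengthening as much as
  weakening: types assumed for an absent variable may be dropped.\<close>

lemma typed_weaken_on:
  "typed t \<Gamma> n A \<Longrightarrow> n \<le> n' \<Longrightarrow> (\<And>i. occ i t > 0 \<Longrightarrow> \<Gamma> i \<subseteq># \<Gamma>' i) \<Longrightarrow> typed t \<Gamma>' n' A"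
proof (induction t arbitrary: \<Gamma> n A \<Gamma>' n')
  case (Var i)
  from Var(3)[of i] have "\<Gamma> i \<subseteq># \<Gamma>' i" by simp
  then show ?case using Var(1) by (auto dest: mset_subset_eqD)
next
  case (Lam t)
  from Lam.prems(1) obtain M B where "A = Arr M B" "typed t (M \<cdot> \<Gamma>) n B" by auto
  moreover from this have "typed t (M \<cdot> \<Gamma>') n' B"
    using Lam.prems(2,3) by (auto split: nat.splits intro!: Lam.IH[OF \<open>typed t (M \<cdot> \<Gamma>) n B\<close>])
  ultimately show ?case by simp
next
  case (App t u)
  from App.prems(1) obtain \<Gamma>1 \<Gamma>2 n1 n2 M where *: "\<Gamma> = \<Gamma>1 + \<Gamma>2" "n = Suc (n1 + n2)" "M \<noteq> {#}"
    "typed t \<Gamma>1 n1 (Arr M A)" "many (typed u) \<Gamma>2 n2 M" by (rule typed_AppE)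
  have "\<forall>i \<in> {i. occ i t > 0} \<union> {i. occ i u > 0}. (\<Gamma>1 + \<Gamma>2) i \<subseteq># \<Gamma>' i"
    unfolding *(1)[symmetric] by (intro ballI App.prems(3)) auto
  from split_above[OF this] obtain G H where GH: "\<Gamma>' = G + H"
    "\<And>i. occ i t > 0 \<Longrightarrow> \<Gamma>1 i \<subseteq># G i" "\<And>i. occ i u > 0 \<Longrightarrow> \<Gamma>2 i \<subseteq># H i" by auto
  have "typed t G n1 (Arr M A)" using *(4) order.refl GH(2) by (rule App.IH(1))
  moreover have "many (typed u) H (n' - Suc n1) M"
    by (rule many_weaken_on[OF *(5), of _ "{i. occ i u > 0}"])
      (use App.prems(2) *(2) GH(3) App.IH(2)[OF _ order.refl] in simp_all)
  ultimately have "typed (App t u) \<Gamma>' (Suc (n1 + (n' - Suc n1))) A"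
    unfolding GH(1) using *(3) by (rule typed_AppI)
  then show ?case using App.prems(2) *(2) by simp
next
  case (Sub t u)
  from Sub.prems(1) obtain \<Gamma>1 \<Gamma>2 n1 n2 M where *: "\<Gamma> = \<Gamma>1 + \<Gamma>2" "n = n1 + n2" "M \<noteq> {#}"
    "typed t (M \<cdot> \<Gamma>1) n1 A" "many (typed u) \<Gamma>2 n2 M" by (rule typed_SubE)
  have "\<forall>i \<in> {i. occ (Suc i) t > 0} \<union> {i. occ i u > 0}. (\<Gamma>1 + \<Gamma>2) i \<subseteq># \<Gamma>' i"
    unfolding *(1)[symmetric] by (intro ballI Sub.prems(3)) auto
  from split_above[OF this] obtain G H where GH: "\<Gamma>' = G + H"
    "\<And>i. occ (Suc i) t > 0 \<Longrightarrow> \<Gamma>1 i \<subseteq># G i" "\<And>i. occ i u > 0 \<Longrightarrow> \<Gamma>2 i \<subseteq># H i" by auto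
  have "typed t (M \<cdot> G) n1 A"
    using GH(2) by (auto split: nat.splits intro!: Sub.IH(1)[OF *(4)])
  moreover have "many (typed u) H (n' - n1) M"
    by (rule many_weaken_on[OF *(5), of _ "{i. occ i u > 0}"])
      (use Sub.prems(2) *(2) GH(3) Sub.IH(2)[OF _ order.refl] in simp_all)
  ultimately have "typed (Sub t u) \<Gamma>' (n1 + (n' - n1)) A"
    unfolding GH(1) using *(3) by (rule typed_SubI)
  then show ?case using Sub.prems(2) *(2) by simp
qed

lemmas typed_weaken = typed_weaken_on[OF _ order.refl]

lemma typed_weaken_plus: "typed t \<Gamma> n A \<Longrightarrow> typed t (\<Gamma> + \<Delta>) (n + m) A"
  and typed_weaken_plus': "typed t \<Gamma> n A \<Longrightarrow> typed t (\<Delta> + \<Gamma>) (m + n) A"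
  by (erule typed_weaken_on; simp)+

lemma typed_weaken_cons: "typed t (M \<cdot> \<Gamma>) n A \<Longrightarrow> M \<subseteq># N \<Longrightarrow> typed t (N \<cdot> \<Gamma>) n A"
  by (erule typed_weaken) (simp split: nat.splits)

lemma many_typed_weaken_on:
  "many (typed t) \<Gamma> n M \<Longrightarrow> n \<le> n' \<Longrightarrow> (\<And>i. occ i t > 0 \<Longrightarrow> \<Gamma> i \<subseteq># \<Gamma>' i) \<Longrightarrow>
   many (typed t) \<Gamma>' n' M"
  by (erule many_weaken_on[where V = "{i. occ i t > 0}"]) (simp, simp, erule typed_weaken, simp)

lemma many_typed_elem:
  assumes "many (typed t) \<Gamma> n M" "A \<in># M" shows "typed t \<Gamma> n A"
  using assms
proof (induction rule: many.induct)
  case (many_add \<Gamma> n B \<Delta> m M)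
  from many_add.prems consider "A = B" | "A \<in># M" by auto
  then show ?case
    by cases (use many_add.hyps(1) many_add.IH in \<open>blast intro: typed_weaken_plus typed_weaken_plus'\<close>)+
qed simp

text \<open>Both splitting rules have nonempty multisets, so every subterm is typed at least once,
  and an occurrence of \<open>i\<close> reaches a variable rule that reads a type from
  \<open>\<Gamma> i\<close>.\<close>

lemma typed_occ_nonempty: "typed t \<Gamma> n A \<Longrightarrow> occ i t > 0 \<Longrightarrow> \<Gamma> i \<noteq> {#}"
proof (induction t arbitrary: \<Gamma> n A i)
  case (App t u)
  from App.prems(1) obtain \<Gamma>1 \<Gamma>2 n1 n2 M where *: "\<Gamma> = \<Gamma>1 + \<Gamma>2" "M \<noteq> {#}"
    "typed t \<Gamma>1 n1 (Arr M A)" "many (typed u) \<Gamma>2 n2 M" by (rule typed_AppE)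
  consider "occ i t > 0" | "occ i u > 0" using App.prems(2) by auto
  then show ?case
  proof cases
    case 1
    then show ?thesis using App.IH(1)[OF *(3)] * by simp
  next
    case 2
    then show ?thesis using many_nonempty[OF *(4)] App.IH(2) * by auto
  qed
next
  case (Sub t u)
  from Sub.prems(1) obtain \<Gamma>1 \<Gamma>2 n1 n2 M where *: "\<Gamma> = \<Gamma>1 + \<Gamma>2" "M \<noteq> {#}"
    "typed t (M \<cdot> \<Gamma>1) n1 A" "many (typed u) \<Gamma>2 n2 M" by (rule typed_SubE)
  consider "occ (Suc i) t > 0" | "occ i u > 0" using Sub.prems(2) by auto
  then show ?case
  proof cases
    case 1
    then show ?thesis using Sub.IH(1)[OF *(3), of "Suc i"] * by simp
  next
    case 2
    then show ?thesis using many_nonempty[OF *(4)] Sub.IH(2) * by auto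
  qed
next
  case (Lam t)
  then obtain M B where "typed t (M \<cdot> \<Gamma>) n B" by auto
  from Lam.IH[OF this, of "Suc i"] show ?case using Lam.prems(2) by simp
qed (auto split: if_splits)

section \<open>Typing and renamings\<close>

lemma cons_comp_ext: "(\<lambda>i. (M \<cdot> \<Gamma>) (ext f i)) = M \<cdot> (\<lambda>i. \<Gamma> (f i))"
  by (rule HOL.ext) (simp split: nat.splits add: ext_def)

lemma typed_of_ren: "typed (ren f t) \<Gamma> n A \<Longrightarrow> typed t (\<lambda>i. \<Gamma> (f i)) n A"
proof (induction t arbitrary: f \<Gamma> n A)
  case (Lam t)
  then show ?case by (fastforce simp: cons_comp_ext)
next
  case (App t u)
  from App.prems obtain \<Gamma>1 \<Gamma>2 n1 n2 M where *: "\<Gamma> = \<Gamma>1 + \<Gamma>2" "n = Suc (n1 + n2)" "M \<noteq> {#}"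
    "typed (ren f t) \<Gamma>1 n1 (Arr M A)" "many (typed (ren f u)) \<Gamma>2 n2 M"
    unfolding ren.simps by (rule typed_AppE)
  have "many (typed u) (\<lambda>i. \<Gamma>2 (f i)) n2 M"
    using *(5) App.IH(2) by (rule many_map) (auto simp: plus_fun_def)
  from typed_AppI[OF App.IH(1)[OF *(4)] this *(3)] show ?case by (simp add: * plus_fun_def)
next
  case (Sub t u)
  from Sub.prems obtain \<Gamma>1 \<Gamma>2 n1 n2 M where *: "\<Gamma> = \<Gamma>1 + \<Gamma>2" "n = n1 + n2" "M \<noteq> {#}"
    "typed (ren (ext f) t) (M \<cdot> \<Gamma>1) n1 A" "many (typed (ren f u)) \<Gamma>2 n2 M"
    unfolding ren.simps by (rule typed_SubE)
  have "many (typed u) (\<lambda>i. \<Gamma>2 (f i)) n2 M"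
    using *(5) Sub.IH(2) by (rule many_map) (auto simp: plus_fun_def)
  from typed_SubI[OF Sub.IH(1)[OF *(4), unfolded cons_comp_ext] this *(3)]
  show ?case by (simp add: * plus_fun_def)
qed simp_all

text \<open>By the left inverse, \<open>t\<close> is itself a renaming of \<open>ren f t\<close>, so
  reading the context along \<open>g\<close> types \<open>ren f t\<close>. Weakening then passes to
  \<open>\<Delta>\<close>, which is unconstrained outside the range of \<open>f\<close> because
  nothing occurs there.\<close>

lemma typed_ren:
  assumes "typed t \<Gamma> n A" "\<And>i. g (f i) = i" "\<And>i. \<Gamma> i \<subseteq># \<Delta> (f i)"
  shows "typed (ren f t) \<Delta> n A"
proof -
  from assms(1,2) have "typed (ren g (ren f t)) \<Gamma> n A" by (simp add: ren_retract)
  from typed_weaken[OF typed_of_ren[OF this]] show ?thesis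
    by (metis assms(2,3) occ_ren_notin less_irrefl)
qed

lemma typed_lift: "typed t \<Gamma> n A \<Longrightarrow> typed (lift t) (M \<cdot> \<Gamma>) n A"
  unfolding lift_def by (erule typed_ren[where g = "\<lambda>i. i - 1"]) auto

lemma typed_of_lift: "typed (lift t) \<Gamma> n A \<Longrightarrow> typed t (\<lambda>i. \<Gamma> (Suc i)) n A"
  unfolding lift_def by (rule typed_of_ren)

lemma typed_lift_iff [simp]: "typed (lift t) (M \<cdot> \<Gamma>) n A \<longleftrightarrow> typed t \<Gamma> n A"
  using typed_lift typed_of_lift[of t "M \<cdot> \<Gamma>"] by auto

lemma many_typed_lift: "many (typed t) \<Gamma> n N \<Longrightarrow> many (typed (lift t)) ({#} \<cdot> \<Gamma>) n N"
  by (erule many_map) (use cons_plus[of "{#}" "{#}"] in \<open>auto intro: typed_lift\<close>)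

lemma many_typed_of_lift: "many (typed (lift t)) \<Gamma> n N \<Longrightarrow> many (typed t) (\<lambda>i. \<Gamma> (Suc i)) n N"
  by (erule many_map) (auto intro: typed_of_lift simp: plus_fun_def)

lemma typed_ren_swap01:
  "typed t (M \<cdot> N \<cdot> \<Gamma>) n A \<Longrightarrow> typed (ren swap01 t) (N \<cdot> M \<cdot> \<Gamma>) n A"
  by (erule typed_ren[where g = swap01]) (auto simp: swap01_def split: nat.splits)


lemma typed_ren_ext_Suc [simp]: "typed (ren (ext Suc) t) (N \<cdot> M \<cdot> \<Gamma>) n A \<longleftrightarrow> typed t (N \<cdot> \<Gamma>) n A"
proof
  show "typed (ren (ext Suc) t) (N \<cdot> M \<cdot> \<Gamma>) n A" if "typed t (N \<cdot> \<Gamma>) n A"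
    by (rule typed_ren[OF that, where g = "ext (\<lambda>i. i - 1)"]) (auto simp: ext_def split: nat.splits)
  show "typed t (N \<cdot> \<Gamma>) n A" if "typed (ren (ext Suc) t) (N \<cdot> M \<cdot> \<Gamma>) n A"
    using typed_of_ren[OF that] by (simp add: cons_comp_ext)
qed

section \<open>Splitting and merging families of derivations\<close>

lemma many_single: "P \<Gamma> n A \<Longrightarrow> many P \<Gamma> n {#A#}"
  using many_add[of P \<Gamma> n A 0 0 "{#}"] by (simp add: many_empty)

lemma many_split:
  assumes "many P \<Gamma> n (M + N)"
  obtains \<Gamma>1 \<Gamma>2 n1 n2 where "\<Gamma> = \<Gamma>1 + \<Gamma>2" "n = n1 + n2" "many P \<Gamma>1 n1 M" "many P \<Gamma>2 n2 N"
proof -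
  have "\<exists>\<Gamma>1 \<Gamma>2 n1 n2. \<Gamma> = \<Gamma>1 + \<Gamma>2 \<and> n = n1 + n2 \<and> many P \<Gamma>1 n1 M \<and> many P \<Gamma>2 n2 N"
    using assms
  proof (induction \<Gamma> n "M + N" arbitrary: M N rule: many.induct)
    case (many_empty \<Gamma> n)
    then have "\<Gamma> = \<Gamma> + 0" "n = n + 0" "many P \<Gamma> n M" "many P 0 0 N"
      by (auto intro: many.many_empty)
    then show ?case by blast
  next
    case (many_add \<Gamma> n A \<Delta> m K)
    have "A \<in># M + N" using many_add.hyps(4) by (metis union_single_eq_member)
    then consider M' where "M = add_mset A M'" | N' where "N = add_mset A N'"
      by (metis mset_add union_iff)
    then show ?case
    proof cases
      case 1
      then obtain \<Delta>1 \<Delta>2 m1 m2 where "\<Delta> = \<Delta>1 + \<Delta>2" "m = m1 + m2" "many P \<Delta>1 m1 M'" "many P \<Delta>2 m2 N"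
        using many_add.hyps(3)[of M' N] many_add.hyps(4) by auto
      moreover from this have "many P (\<Gamma> + \<Delta>1) (n + m1) M"
        unfolding 1 by (intro many.many_add many_add.hyps(1))
      moreover have "\<Gamma> + \<Delta> = (\<Gamma> + \<Delta>1) + \<Delta>2" "n + m = (n + m1) + m2"
        using calculation by (simp_all add: add.assoc)
      ultimately show ?thesis by blast
    next
      case 2
      then obtain \<Delta>1 \<Delta>2 m1 m2 where "\<Delta> = \<Delta>1 + \<Delta>2" "m = m1 + m2" "many P \<Delta>1 m1 M" "many P \<Delta>2 m2 N'"
        using many_add.hyps(3)[of M N'] many_add.hyps(4) by auto
      moreover from this have "many P (\<Gamma> + \<Delta>2) (n + m2) N"
        unfolding 2 by (intro many.many_add many_add.hyps(1))
      moreover have "\<Gamma> + \<Delta> = \<Delta>1 + (\<Gamma> + \<Delta>2)" "n + m = m1 + (n + m2)"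
        using calculation by (simp_all add: add.left_commute)
      ultimately show ?thesis by blast
    qed
  qed
  then show ?thesis using that by blast
qed

lemma many_slack: "many P \<Gamma> n M \<Longrightarrow> many P (\<Gamma> + \<Delta>) (n + m) M"
proof (induction rule: many.induct)
  case (many_add \<Gamma>' n' A \<Delta>' m' M)
  from many.many_add[where P = P, OF many_add.hyps(1) many_add.IH] show ?case
    by (simp only: ac_simps)
qed (rule many.many_empty)

lemma many_union:
  assumes "many P \<Gamma> n M" "many P \<Delta> m N"
  shows "many P (\<Gamma> + \<Delta>) (n + m) (M + N)"
  using assms(1)
proof (induction rule: many.induct)
  case (many_empty \<Gamma> n)
  show ?case using many_slack[OF assms(2), of \<Gamma> n] by (simp only: add_0 ac_simps)
next
  case (many_add \<Gamma> n A \<Delta>' m' M)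
  from many.many_add[where P = P, OF many_add.hyps(1) many_add.IH] show ?case
    unfolding union_mset_add_mset_left by (simp only: ac_simps)
qed


section \<open>Substitution and anti-substitution\<close>

text \<open>The extension \<open>M \<cdot> \<Gamma>\<close> generalized to position
  \<open>k\<close>, as the induction on \<open>subst\<close> requires, where \<open>k\<close> moves
  up under each binder.\<close>

definition ins :: "nat \<Rightarrow> ty multiset \<Rightarrow> ctx \<Rightarrow> ctx" where
  "ins k M \<Gamma> i = (if i < k then \<Gamma> i else if i = k then M else \<Gamma> (i - 1))"

lemma ins_0: "ins 0 M \<Gamma> = M \<cdot> \<Gamma>"
  by (rule HOL.ext) (simp add: ins_def split: nat.splits)

lemma ins_Suc_cons: "ins (Suc k) M (N \<cdot> \<Gamma>) = N \<cdot> ins k M \<Gamma>"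
  by (rule HOL.ext) (auto simp: ins_def split: nat.splits)

lemma ins_plus: "ins k (M + N) (\<Gamma> + \<Delta>) = ins k M \<Gamma> + ins k N \<Delta>"
  by (rule HOL.ext) (simp add: ins_def)

lemma ins_eq_plusE:
  assumes "ins k M \<Gamma> = G + H"
  obtains M1 M2 \<Gamma>1 \<Gamma>2 where "G = ins k M1 \<Gamma>1" "H = ins k M2 \<Gamma>2" "M = M1 + M2" "\<Gamma> = \<Gamma>1 + \<Gamma>2"
proof
  let ?del = "\<lambda>G i. if i < k then G i else G (Suc i)"
  show "G = ins k (G k) (?del G)" "H = ins k (H k) (?del H)"
    by (intro HOL.ext; auto simp: ins_def)+
  show "M = G k + H k" using fun_cong[OF assms, of k] by (simp add: ins_def)
  show "\<Gamma> = ?del G + ?del H"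
  proof
    fix i
    show "\<Gamma> i = (?del G + ?del H) i"
      using fun_cong[OF assms, of i] fun_cong[OF assms, of "Suc i"] by (auto simp: ins_def)
  qed
qed

text \<open>Unlike \<open>typed (Sub t u)\<close>, \<open>cut_rule (typed t) (typed u) 0\<close> leaves \<open>u\<close> untyped when
  the multiset is empty. It characterizes \<open>subst t k u\<close> in both directions.\<close>
definition cut_rule :: "(ctx \<Rightarrow> nat \<Rightarrow> 'a \<Rightarrow> bool) \<Rightarrow> (ctx \<Rightarrow> nat \<Rightarrow> ty \<Rightarrow> bool) \<Rightarrow> nat \<Rightarrow> ctx \<Rightarrow> nat \<Rightarrow> 'a \<Rightarrow> bool" where
  "cut_rule P R k \<Gamma> n A \<longleftrightarrow> (\<exists>\<Gamma>1 \<Gamma>2 n1 n2 M. \<Gamma> = \<Gamma>1 + \<Gamma>2 \<and> n = n1 + n2 \<and>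
     P (ins k M \<Gamma>1) n1 A \<and> many R \<Gamma>2 n2 M)"

lemma cutI: "P (ins k M \<Gamma>) n A \<Longrightarrow> many R \<Delta> m M \<Longrightarrow> cut_rule P R k (\<Gamma> + \<Delta>) (n + m) A"
  unfolding cut_rule_def by blast

lemma cutI_void: "P (ins k {#} \<Gamma>) n A \<Longrightarrow> cut_rule P R k \<Gamma> n A"
  using cutI[of P k "{#}" \<Gamma> n A R 0 0] by (simp add: many_empty)

lemma cutE:
  assumes "cut_rule P R k \<Gamma> n A"
  obtains \<Gamma>1 \<Gamma>2 n1 n2 M where "\<Gamma> = \<Gamma>1 + \<Gamma>2" "n = n1 + n2" "P (ins k M \<Gamma>1) n1 A" "many R \<Gamma>2 n2 M"
  using assms unfolding cut_rule_def by blast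

text \<open>Two cuts against the same \<open>R\<close> merge by adding their multisets, through any
  rule \<open>S\<close> that adds contexts and bounds. The conclusions are polymorphic so that a
  premise may be a single derivation or a whole family.\<close>

lemma cut_plus:
  assumes "cut_rule P R k \<Gamma> n A" "cut_rule Q R k \<Delta> m B"
    and "\<And>G i H j. P G i A \<Longrightarrow> Q H j B \<Longrightarrow> S (G + H) (i + j) C"
  shows "cut_rule S R k (\<Gamma> + \<Delta>) (n + m) C"
proof -
  from assms(1) obtain \<Gamma>1 \<Gamma>2 n1 n2 M where 1: "\<Gamma> = \<Gamma>1 + \<Gamma>2" "n = n1 + n2"
    "P (ins k M \<Gamma>1) n1 A" "many R \<Gamma>2 n2 M" by (rule cutE)
  from assms(2) obtain \<Delta>1 \<Delta>2 m1 m2 N where 2: "\<Delta> = \<Delta>1 + \<Delta>2" "m = m1 + m2"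
    "Q (ins k N \<Delta>1) m1 B" "many R \<Delta>2 m2 N" by (rule cutE)
  have "S (ins k (M + N) (\<Gamma>1 + \<Delta>1)) (n1 + m1) C"
    unfolding ins_plus using 1(3) 2(3) by (rule assms(3))
  from cutI[where P = S, OF this many_union[OF 1(4) 2(4)]] show ?thesis
    by (simp add: 1 2 ac_simps)
qed

lemma cut_split:
  assumes "ins k M \<Gamma> = G + H" "P G i A" "Q H j B" "many R \<Delta> m M"
  obtains \<Gamma>1 \<Gamma>2 n1 n2 where "\<Gamma> + \<Delta> = \<Gamma>1 + \<Gamma>2" "i + j + m = n1 + n2"
    "cut_rule P R k \<Gamma>1 n1 A" "cut_rule Q R k \<Gamma>2 n2 B"
proof -
  from assms(1) obtain M1 M2 G1 G2 where 1: "G = ins k M1 G1" "H = ins k M2 G2" "M = M1 + M2" "\<Gamma> = G1 + G2"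
    by (rule ins_eq_plusE)
  from assms(4)[unfolded 1] obtain \<Delta>1 \<Delta>2 m1 m2 where 2: "\<Delta> = \<Delta>1 + \<Delta>2" "m = m1 + m2"
    "many R \<Delta>1 m1 M1" "many R \<Delta>2 m2 M2" by (rule many_split)
  show ?thesis
  proof (rule that)
    show "cut_rule P R k (G1 + \<Delta>1) (i + m1) A" using assms(2) 2(3) unfolding 1 by (rule cutI)
    show "cut_rule Q R k (G2 + \<Delta>2) (j + m2) B" using assms(3) 2(4) unfolding 1 by (rule cutI)
  qed (simp_all add: 1 2 ac_simps)
qed

text \<open>This is how a jump crosses the boundary of a term that is typed several times: cutting
  each member of a family separately amounts to cutting the family once against the pooled multiset.
  Pooling adds the multisets; conversely, the pooled derivations are split along the summands of the
  context.\<close>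

lemma many_cut: "many (cut_rule P R k) \<Gamma> n N \<longleftrightarrow> cut_rule (many P) R k \<Gamma> n N"
proof
  assume "many (cut_rule P R k) \<Gamma> n N"
  then show "cut_rule (many P) R k \<Gamma> n N"
  proof (induction rule: many.induct)
    case (many_add \<Gamma> n A \<Delta> m M)
    show ?case by (rule cut_plus[OF many_add.hyps(1) many_add.IH]) (rule many.many_add)
  qed (auto intro: cutI_void many.many_empty)
next
  have "many (cut_rule P R k) (\<Gamma> + \<Delta>) (n + m) N" if "many P G n N" "G = ins k M \<Gamma>" "many R \<Delta> m M" for \<Gamma> \<Delta> n m G M
    using that
  proof (induction arbitrary: \<Gamma> M \<Delta> m rule: many.induct)
    case (many_add G1 n1 A G2 n2 N)
    from many_add.prems(1)[symmetric] obtain M1 M2 H1 H2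
      where 1: "G1 = ins k M1 H1" "G2 = ins k M2 H2" "M = M1 + M2" "\<Gamma> = H1 + H2"
      by (rule ins_eq_plusE)
    from many_add.prems(2)[unfolded 1] obtain \<Delta>1 \<Delta>2 m1 m2 where 2: "\<Delta> = \<Delta>1 + \<Delta>2" "m = m1 + m2"
      "many R \<Delta>1 m1 M1" "many R \<Delta>2 m2 M2" by (rule many_split)
    have "cut_rule P R k (H1 + \<Delta>1) (n1 + m1) A"
      using many_add.hyps(1) 2(3) unfolding 1 by (rule cutI)
    from many.many_add[where P = "cut_rule P R k", OF this many_add.IH[OF 1(2) 2(4)]]
    show ?case by (simp only: 1 2 ac_simps)
  qed (rule many.many_empty)
  moreover assume "cut_rule (many P) R k \<Gamma> n N"
  ultimately show "many (cut_rule P R k) \<Gamma> n N" by (elim cutE) blast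
qed

lemma cut_lift:
  "cut_rule (typed t) (typed (lift u)) (Suc k) (N \<cdot> \<Gamma>) n A \<longleftrightarrow> cut_rule (\<lambda>\<Gamma>. typed t (N \<cdot> \<Gamma>)) (typed u) k \<Gamma> n A"
proof
  assume "cut_rule (typed t) (typed (lift u)) (Suc k) (N \<cdot> \<Gamma>) n A"
  then obtain \<Gamma>1 \<Gamma>2 n1 n2 M where *: "N \<cdot> \<Gamma> = \<Gamma>1 + \<Gamma>2" "n = n1 + n2"
    "typed t (ins (Suc k) M \<Gamma>1) n1 A" "many (typed (lift u)) \<Gamma>2 n2 M" by (rule cutE)
  from *(1) obtain N1 N2 G1 G2 where 1: "\<Gamma>1 = N1 \<cdot> G1" "\<Gamma>2 = N2 \<cdot> G2" "N = N1 + N2" "\<Gamma> = G1 + G2"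
    by (rule cons_eq_plusE)
  \<comment> \<open>Weakening may have let the derivations of \<open>lift u\<close> carry a part
    \<open>N2\<close> of the types of index 0, which does not occur there; that part is returned to
    \<open>t\<close>.\<close>
  have "typed t (N \<cdot> ins k M G1) n1 A"
    using *(3) unfolding 1 ins_Suc_cons by (rule typed_weaken_cons) simp
  moreover have "many (typed u) G2 n2 M"
    using many_typed_of_lift[OF *(4)] by (simp add: 1)
  ultimately show "cut_rule (\<lambda>\<Gamma>. typed t (N \<cdot> \<Gamma>)) (typed u) k \<Gamma> n A"
    unfolding 1 * by (rule cutI)
next
  assume "cut_rule (\<lambda>\<Gamma>. typed t (N \<cdot> \<Gamma>)) (typed u) k \<Gamma> n A"
  then obtain \<Gamma>1 \<Gamma>2 n1 n2 M where *: "\<Gamma> = \<Gamma>1 + \<Gamma>2" "n = n1 + n2"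
    "typed t (N \<cdot> ins k M \<Gamma>1) n1 A" "many (typed u) \<Gamma>2 n2 M" by (rule cutE)
  from *(3) have "typed t (ins (Suc k) M (N \<cdot> \<Gamma>1)) n1 A" by (simp add: ins_Suc_cons)
  from cutI[where P = "typed t", OF this many_typed_lift[OF *(4)]]
  show "cut_rule (typed t) (typed (lift u)) (Suc k) (N \<cdot> \<Gamma>) n A"
    using cons_plus[of N "{#}" \<Gamma>1 \<Gamma>2] by (simp add: *)
qed

text \<open>From left to right this is anti-substitution, from right to left the substitution lemma,
  with the same bound on both sides: derivations of \<open>u\<close> that the result does not use
  vanish into the slack of context and bound.\<close>

theorem typed_subst_iff: "typed (subst t k u) \<Gamma> n A \<longleftrightarrow> cut_rule (typed t) (typed u) k \<Gamma> n A"
proof (induction t arbitrary: k u \<Gamma> n A)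
  case (Var i)
  show ?case
  proof (cases "i = k")
    case True
    have "typed u \<Gamma> n A" if "cut_rule (typed (Var i)) (typed u) k \<Gamma> n A"
      using that
    proof (rule cutE)
      fix \<Gamma>1 \<Gamma>2 n1 n2 M
      assume *: "\<Gamma> = \<Gamma>1 + \<Gamma>2" "n = n1 + n2" "typed (Var i) (ins k M \<Gamma>1) n1 A" "many (typed u) \<Gamma>2 n2 M"
      \<comment> \<open>A single member of the family is used; contexts and bounds of the others are
        absorbed by weakening.\<close>
      then have "A \<in># M" using True by (simp add: ins_def)
      from many_typed_elem[OF *(4) this] show ?thesis unfolding * by (rule typed_weaken_plus')
    qed
    moreover have "cut_rule (typed (Var i)) (typed u) k \<Gamma> n A" if "typed u \<Gamma> n A"
      using cutI[of "typed (Var i)" k "{#A#}" 0 0 A "typed u" \<Gamma> n] many_single[of "typed u", OF that]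
      by (simp add: ins_def True)
    ultimately show ?thesis using True by auto
  next
    case False
    have "typed (subst (Var i) k u) \<Gamma> n A" if "cut_rule (typed (Var i)) (typed u) k \<Gamma> n A"
      using that by (rule cutE) (use False in \<open>auto simp: ins_def split: if_splits\<close>)
    moreover have "cut_rule (typed (Var i)) (typed u) k \<Gamma> n A" if "typed (subst (Var i) k u) \<Gamma> n A"
      using that by (intro cutI_void) (use False in \<open>auto simp: ins_def split: if_splits\<close>)
    ultimately show ?thesis by blast
  qed
next
  case (Lam t)
  have "typed (subst (Lam t) k u) \<Gamma> n A \<longleftrightarrow>
    (\<exists>N B. A = Arr N B \<and> cut_rule (\<lambda>\<Gamma>. typed t (N \<cdot> \<Gamma>)) (typed u) k \<Gamma> n B)"
    by (simp add: Lam cut_lift)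
  also have "\<dots> \<longleftrightarrow> cut_rule (typed (Lam t)) (typed u) k \<Gamma> n A"
    unfolding cut_rule_def typed.simps by blast
  finally show ?case .
next
  case (App t v)
  have IH2: "many (typed (subst v k u)) \<Gamma> n N \<longleftrightarrow> cut_rule (many (typed v)) (typed u) k \<Gamma> n N" for \<Gamma> n N
  proof -
    \<comment> \<open>As an equality of relations the induction hypothesis can be applied under
      \<open>many\<close>, and \<open>many_cut\<close> then pools the resources of \<open>u\<close>
      over all copies of \<open>v\<close>.\<close>
    have "typed (subst v k u) = cut_rule (typed v) (typed u) k" by (intro HOL.ext) (rule App.IH(2))
    then show ?thesis by (simp only: many_cut)
  qed
  show ?case
  proof
    assume "typed (subst (App t v) k u) \<Gamma> n A"
    then obtain \<Gamma>1 \<Gamma>2 n1 n2 M where *: "\<Gamma> = \<Gamma>1 + \<Gamma>2" "n = Suc (n1 + n2)" "M \<noteq> {#}"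
      "cut_rule (typed t) (typed u) k \<Gamma>1 n1 (Arr M A)" "cut_rule (many (typed v)) (typed u) k \<Gamma>2 n2 M"
      unfolding subst.simps App.IH(1)[symmetric] IH2[symmetric] by (rule typed_AppE)
    from *(4) obtain G1 G2 i1 i2 K where 1: "\<Gamma>1 = G1 + G2" "n1 = i1 + i2"
      "typed t (ins k K G1) i1 (Arr M A)" "many (typed u) G2 i2 K" by (rule cutE)
    from *(5) obtain H1 H2 j1 j2 L where 2: "\<Gamma>2 = H1 + H2" "n2 = j1 + j2"
      "many (typed v) (ins k L H1) j1 M" "many (typed u) H2 j2 L" by (rule cutE)
    have "typed (App t v) (ins k (K + L) (G1 + H1)) (Suc (i1 + j1)) A"
      unfolding ins_plus using 1(3) 2(3) *(3) by (rule typed_AppI)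
    from cutI[where P = "typed (App t v)", OF this many_union[OF 1(4) 2(4)]]
    show "cut_rule (typed (App t v)) (typed u) k \<Gamma> n A" by (simp add: * 1 2 ac_simps)
  next
    assume "cut_rule (typed (App t v)) (typed u) k \<Gamma> n A"
    then obtain \<Gamma>1 \<Gamma>2 n1 n2 M where *: "\<Gamma> = \<Gamma>1 + \<Gamma>2" "n = n1 + n2"
      "typed (App t v) (ins k M \<Gamma>1) n1 A" "many (typed u) \<Gamma>2 n2 M" by (rule cutE)
    from *(3) obtain G H i j N where 1: "ins k M \<Gamma>1 = G + H" "n1 = Suc (i + j)" "N \<noteq> {#}"
      "typed t G i (Arr N A)" "many (typed v) H j N" by (rule typed_AppE)
    from cut_split[where P = "typed t" and Q = "many (typed v)", OF 1(1,4,5) *(4)]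
    obtain \<Delta>1 \<Delta>2 m1 m2 where 2: "\<Gamma>1 + \<Gamma>2 = \<Delta>1 + \<Delta>2" "i + j + n2 = m1 + m2"
      "typed (subst t k u) \<Delta>1 m1 (Arr N A)" "many (typed (subst v k u)) \<Delta>2 m2 N"
      unfolding App.IH(1)[symmetric] IH2[symmetric] by blast
    from typed_AppI[OF 2(3,4) 1(3)] show "typed (subst (App t v) k u) \<Gamma> n A"
      by (simp add: * 1 2)
  qed
next
  case (Sub t v)
  have IH1: "typed (subst t (Suc k) (lift u)) (N \<cdot> \<Gamma>) n A \<longleftrightarrow>
    cut_rule (\<lambda>\<Gamma>. typed t (N \<cdot> \<Gamma>)) (typed u) k \<Gamma> n A" for N \<Gamma> n A
    by (simp add: Sub.IH(1) cut_lift)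
  have IH2: "many (typed (subst v k u)) \<Gamma> n N \<longleftrightarrow> cut_rule (many (typed v)) (typed u) k \<Gamma> n N" for \<Gamma> n N
  proof -
    have "typed (subst v k u) = cut_rule (typed v) (typed u) k" by (intro HOL.ext) (rule Sub.IH(2))
    then show ?thesis by (simp only: many_cut)
  qed
  show ?case
  proof
    assume "typed (subst (Sub t v) k u) \<Gamma> n A"
    then obtain \<Gamma>1 \<Gamma>2 n1 n2 M where *: "\<Gamma> = \<Gamma>1 + \<Gamma>2" "n = n1 + n2" "M \<noteq> {#}"
      "cut_rule (\<lambda>\<Gamma>. typed t (M \<cdot> \<Gamma>)) (typed u) k \<Gamma>1 n1 A" "cut_rule (many (typed v)) (typed u) k \<Gamma>2 n2 M"
      unfolding subst.simps IH1[symmetric] IH2[symmetric] by (rule typed_SubE)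
    have "cut_rule (typed (Sub t v)) (typed u) k (\<Gamma>1 + \<Gamma>2) (n1 + n2) A"
      by (rule cut_plus[OF *(4,5)]) (rule typed_SubI[OF _ _ *(3)])
    then show "cut_rule (typed (Sub t v)) (typed u) k \<Gamma> n A" by (simp add: *)
  next
    assume "cut_rule (typed (Sub t v)) (typed u) k \<Gamma> n A"
    then obtain \<Gamma>1 \<Gamma>2 n1 n2 M where *: "\<Gamma> = \<Gamma>1 + \<Gamma>2" "n = n1 + n2"
      "typed (Sub t v) (ins k M \<Gamma>1) n1 A" "many (typed u) \<Gamma>2 n2 M" by (rule cutE)
    from *(3) obtain G H i j N where 1: "ins k M \<Gamma>1 = G + H" "n1 = i + j" "N \<noteq> {#}"
      "typed t (N \<cdot> G) i A" "many (typed v) H j N" by (rule typed_SubE)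
    from cut_split[where P = "\<lambda>\<Gamma>. typed t (N \<cdot> \<Gamma>)" and Q = "many (typed v)", OF 1(1,4,5) *(4)]
    obtain \<Delta>1 \<Delta>2 m1 m2 where 2: "\<Gamma>1 + \<Gamma>2 = \<Delta>1 + \<Delta>2" "i + j + n2 = m1 + m2"
      "typed (subst t (Suc k) (lift u)) (N \<cdot> \<Delta>1) m1 A" "many (typed (subst v k u)) \<Delta>2 m2 N"
      unfolding IH1[symmetric] IH2[symmetric] by blast
    from typed_SubI[OF 2(3,4) 1(3)] show "typed (subst (Sub t v) k u) \<Gamma> n A"
      by (simp add: * 1 2)
  qed
qed

lemma cut_of_typed_Sub: "typed (Sub t u) \<Gamma> n A \<Longrightarrow> cut_rule (typed t) (typed u) 0 \<Gamma> n A"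
  by (auto elim!: typed_SubE intro!: cutI simp: ins_0)

text \<open>An occurrence of the variable forces the multiset to be nonempty, so the jump rule and
  the cut rule coincide. Here the condition \<open>occ 0 v > 0\<close> of \<open>ax_appr\<close> and
  \<open>ax_box\<close> takes effect on types, since it makes \<open>many_cut\<close> applicable to
  jumps.\<close>

lemma typed_Sub_eq_cut:
  assumes "occ 0 t > 0" shows "typed (Sub t u) = cut_rule (typed t) (typed u) 0"
proof (intro HOL.ext iffI)
  fix \<Gamma> n A assume "cut_rule (typed t) (typed u) 0 \<Gamma> n A"
  then obtain \<Gamma>1 \<Gamma>2 n1 n2 M where *: "\<Gamma> = \<Gamma>1 + \<Gamma>2" "n = n1 + n2"
    "typed t (M \<cdot> \<Gamma>1) n1 A" "many (typed u) \<Gamma>2 n2 M" unfolding ins_0[symmetric] by (rule cutE)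
  have "M \<noteq> {#}" using typed_occ_nonempty[OF *(3) assms] by simp
  from typed_SubI[OF *(3,4) this] show "typed (Sub t u) \<Gamma> n A" by (simp add: *)
qed (rule cut_of_typed_Sub)



section \<open>Invariance under the substitution equivalence\<close>

text \<open>One direction is enough: exchanging the roles of the two jumps turns the statement into
  its converse, up to the involution \<open>swap01\<close>.\<close>

lemma typed_perm:
  assumes "typed (Sub (Sub t (lift s)) v) \<Gamma> n A"
  shows "typed (Sub (Sub (ren swap01 t) (lift v)) s) \<Gamma> n A"
proof -
  from assms obtain \<Gamma>1 \<Gamma>2 n1 n2 M where 1: "\<Gamma> = \<Gamma>1 + \<Gamma>2" "n = n1 + n2" "M \<noteq> {#}"
    "typed (Sub t (lift s)) (M \<cdot> \<Gamma>1) n1 A" "many (typed v) \<Gamma>2 n2 M" by (rule typed_SubE)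
  from 1(4) obtain G H i j N where 2: "M \<cdot> \<Gamma>1 = G + H" "n1 = i + j" "N \<noteq> {#}"
    "typed t (N \<cdot> G) i A" "many (typed (lift s)) H j N" by (rule typed_SubE)
  from 2(1) obtain M1 M2 \<Delta>1 \<Delta>2 where 3: "G = M1 \<cdot> \<Delta>1" "H = M2 \<cdot> \<Delta>2" "M = M1 + M2" "\<Gamma>1 = \<Delta>1 + \<Delta>2"
    by (rule cons_eq_plusE)
  \<comment> \<open>\<open>M2\<close> is the share of \<open>M\<close> that the derivations of
    \<open>lift s\<close> hold by weakening; it goes back to the body.\<close>
  from 2(4) have "typed (ren swap01 t) (M \<cdot> N \<cdot> \<Delta>1) i A"
    unfolding 3 by (rule typed_weaken_cons[OF typed_ren_swap01 mset_subset_eq_add_left])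
  from typed_SubI[OF this many_typed_lift[OF 1(5)] 1(3)]
  have "typed (Sub (ren swap01 t) (lift v)) (N \<cdot> (\<Delta>1 + \<Gamma>2)) (i + n2) A"
    using cons_plus[of N "{#}" \<Delta>1 \<Gamma>2] by simp
  moreover have "many (typed s) \<Delta>2 j N" using many_typed_of_lift[OF 2(5)] by (simp add: 3)
  ultimately have "typed (Sub (Sub (ren swap01 t) (lift v)) s) (\<Delta>1 + \<Gamma>2 + \<Delta>2) (i + n2 + j) A"
    using 2(3) by (rule typed_SubI)
  then show ?thesis by (simp only: 1(1,2) 2(2) 3(4) ac_simps)
qed

lemma typed_Lam_Sub: "typed (Lam (Sub t (lift s))) = typed (Sub (Lam (ren swap01 t)) s)"
proof (intro HOL.ext iffI)
  fix \<Gamma> n A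
  assume "typed (Lam (Sub t (lift s))) \<Gamma> n A"
  then obtain M B where A: "A = Arr M B" and "typed (Sub t (lift s)) (M \<cdot> \<Gamma>) n B" by auto
  from this(2) obtain G H i j N where 1: "M \<cdot> \<Gamma> = G + H" "n = i + j" "N \<noteq> {#}"
    "typed t (N \<cdot> G) i B" "many (typed (lift s)) H j N" by (rule typed_SubE)
  from 1(1) obtain M1 M2 \<Delta>1 \<Delta>2 where 2: "G = M1 \<cdot> \<Delta>1" "H = M2 \<cdot> \<Delta>2" "M = M1 + M2" "\<Gamma> = \<Delta>1 + \<Delta>2"
    by (rule cons_eq_plusE)
  from 1(4) have "typed (ren swap01 t) (M \<cdot> N \<cdot> \<Delta>1) i B"
    unfolding 2 by (rule typed_weaken_cons[OF typed_ren_swap01 mset_subset_eq_add_left])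
  then have "typed (Lam (ren swap01 t)) (N \<cdot> \<Delta>1) i A" by (simp add: A)
  moreover have "many (typed s) \<Delta>2 j N" using many_typed_of_lift[OF 1(5)] by (simp add: 2)
  ultimately show "typed (Sub (Lam (ren swap01 t)) s) \<Gamma> n A"
    unfolding 1(2) 2(4) using 1(3) by (rule typed_SubI)
next
  fix \<Gamma> n A
  assume "typed (Sub (Lam (ren swap01 t)) s) \<Gamma> n A"
  then obtain \<Gamma>1 \<Gamma>2 n1 n2 N where 1: "\<Gamma> = \<Gamma>1 + \<Gamma>2" "n = n1 + n2" "N \<noteq> {#}"
    "typed (Lam (ren swap01 t)) (N \<cdot> \<Gamma>1) n1 A" "many (typed s) \<Gamma>2 n2 N" by (rule typed_SubE)
  from 1(4) obtain M B where A: "A = Arr M B" and "typed (ren swap01 t) (M \<cdot> N \<cdot> \<Gamma>1) n1 B" by auto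
  from typed_ren_swap01[OF this(2)] have "typed t (N \<cdot> M \<cdot> \<Gamma>1) n1 B" by simp
  from typed_SubI[OF this many_typed_lift[OF 1(5)] 1(3)]
  have "typed (Sub t (lift s)) (M \<cdot> \<Gamma>) n B"
    using cons_plus[of M "{#}" \<Gamma>1 \<Gamma>2] by (simp add: 1(1,2))
  then show "typed (Lam (Sub t (lift s))) \<Gamma> n A" by (simp add: A)
qed

lemma typed_App_Sub_left: "typed (App (Sub t s) v) = typed (Sub (App t (lift v)) s)"
proof (intro HOL.ext iffI)
  fix \<Gamma> n A
  assume "typed (App (Sub t s) v) \<Gamma> n A"
  then obtain \<Gamma>1 \<Gamma>2 n1 n2 M where 1: "\<Gamma> = \<Gamma>1 + \<Gamma>2" "n = Suc (n1 + n2)" "M \<noteq> {#}"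
    "typed (Sub t s) \<Gamma>1 n1 (Arr M A)" "many (typed v) \<Gamma>2 n2 M" by (rule typed_AppE)
  from 1(4) obtain G H i j N where 2: "\<Gamma>1 = G + H" "n1 = i + j" "N \<noteq> {#}"
    "typed t (N \<cdot> G) i (Arr M A)" "many (typed s) H j N" by (rule typed_SubE)
  from typed_AppI[OF 2(4) many_typed_lift[OF 1(5)] 1(3)]
  have "typed (App t (lift v)) (N \<cdot> (G + \<Gamma>2)) (Suc (i + n2)) A"
    using cons_plus[of N "{#}" G \<Gamma>2] by simp
  from typed_SubI[OF this 2(5,3)] show "typed (Sub (App t (lift v)) s) \<Gamma> n A"
    by (simp only: 1(1,2) 2(1,2) ac_simps add_Suc add_Suc_right)
next
  fix \<Gamma> n A
  assume "typed (Sub (App t (lift v)) s) \<Gamma> n A"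
  then obtain \<Gamma>1 \<Gamma>2 n1 n2 N where 1: "\<Gamma> = \<Gamma>1 + \<Gamma>2" "n = n1 + n2" "N \<noteq> {#}"
    "typed (App t (lift v)) (N \<cdot> \<Gamma>1) n1 A" "many (typed s) \<Gamma>2 n2 N" by (rule typed_SubE)
  from 1(4) obtain G H i j M where 2: "N \<cdot> \<Gamma>1 = G + H" "n1 = Suc (i + j)" "M \<noteq> {#}"
    "typed t G i (Arr M A)" "many (typed (lift v)) H j M" by (rule typed_AppE)
  from 2(1) obtain N1 N2 \<Delta>1 \<Delta>2 where 3: "G = N1 \<cdot> \<Delta>1" "H = N2 \<cdot> \<Delta>2" "N = N1 + N2" "\<Gamma>1 = \<Delta>1 + \<Delta>2"
    by (rule cons_eq_plusE)
  from 2(4) have "typed t (N \<cdot> \<Delta>1) i (Arr M A)" unfolding 3 by (rule typed_weaken_cons) simp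
  from typed_SubI[OF this 1(5,3)] have "typed (Sub t s) (\<Delta>1 + \<Gamma>2) (i + n2) (Arr M A)" .
  moreover have "many (typed v) \<Delta>2 j M" using many_typed_of_lift[OF 2(5)] by (simp add: 3)
  ultimately have "typed (App (Sub t s) v) (\<Delta>1 + \<Gamma>2 + \<Delta>2) (Suc (i + n2 + j)) A"
    using 2(3) by (rule typed_AppI)
  then show "typed (App (Sub t s) v) \<Gamma> n A" by (simp only: 1(1,2) 2(2) 3(4) ac_simps add_Suc add_Suc_right)
qed

text \<open>Inside the argument, \<open>u\<close> is typed anew for each copy of \<open>v\<close>,
  so its derivations are pooled or shared out by \<open>many_cut\<close>. For a void jump the two
  sides would disagree: outside, one derivation of \<open>u\<close> is enough, while inside each
  copy of \<open>v\<close> demands its own.\<close>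

lemma typed_App_Sub_right:
  assumes "occ 0 v > 0"
  shows "typed (Sub (App (lift t) v) u) = typed (App t (Sub v u))"
proof (intro HOL.ext iffI)
  fix \<Gamma> n A
  assume "typed (Sub (App (lift t) v) u) \<Gamma> n A"
  then obtain \<Gamma>1 \<Gamma>2 n1 n2 M where 1: "\<Gamma> = \<Gamma>1 + \<Gamma>2" "n = n1 + n2" "M \<noteq> {#}"
    "typed (App (lift t) v) (M \<cdot> \<Gamma>1) n1 A" "many (typed u) \<Gamma>2 n2 M" by (rule typed_SubE)
  from 1(4) obtain G H i j N where 2: "M \<cdot> \<Gamma>1 = G + H" "n1 = Suc (i + j)" "N \<noteq> {#}"
    "typed (lift t) G i (Arr N A)" "many (typed v) H j N" by (rule typed_AppE)
  from 2(1) obtain M1 M2 \<Delta>1 \<Delta>2 where 3: "G = M1 \<cdot> \<Delta>1" "H = M2 \<cdot> \<Delta>2" "M = M1 + M2" "\<Gamma>1 = \<Delta>1 + \<Delta>2"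
    by (rule cons_eq_plusE)
  \<comment> \<open>The share \<open>M1\<close> of the types of the jump variable that went to
    \<open>lift t\<close> is moved over to \<open>v\<close>, so that all resources of
    \<open>u\<close> can follow \<open>v\<close>.\<close>
  have "many (typed v) (ins 0 M \<Delta>2) j N"
    using 2(5) by (rule many_typed_weaken_on) (simp_all add: ins_0 3 split: nat.splits)
  from cutI[where P = "many (typed v)", OF this 1(5)]
  have "many (typed (Sub v u)) (\<Delta>2 + \<Gamma>2) (j + n2) N"
    by (simp only: typed_Sub_eq_cut[OF assms] many_cut)
  moreover have "typed t \<Delta>1 i (Arr N A)" using 2(4) by (simp add: 3)
  ultimately have "typed (App t (Sub v u)) (\<Delta>1 + (\<Delta>2 + \<Gamma>2)) (Suc (i + (j + n2))) A"
    using 2(3) by (intro typed_AppI)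
  then show "typed (App t (Sub v u)) \<Gamma> n A" by (simp only: 1(1,2) 2(2) 3(4) ac_simps add_Suc add_Suc_right)
next
  fix \<Gamma> n A
  assume "typed (App t (Sub v u)) \<Gamma> n A"
  then obtain \<Gamma>1 \<Gamma>2 n1 n2 N where 1: "\<Gamma> = \<Gamma>1 + \<Gamma>2" "n = Suc (n1 + n2)" "N \<noteq> {#}"
    "typed t \<Gamma>1 n1 (Arr N A)" "cut_rule (many (typed v)) (typed u) 0 \<Gamma>2 n2 N"
    unfolding many_cut[symmetric] typed_Sub_eq_cut[OF assms, symmetric] by (rule typed_AppE)
  from 1(5) obtain G H i j M where 2: "\<Gamma>2 = G + H" "n2 = i + j"
    "many (typed v) (M \<cdot> G) i N" "many (typed u) H j M" unfolding ins_0[symmetric] by (rule cutE)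
  from typed_AppI[OF typed_lift[OF 1(4), of "{#}"] 2(3) 1(3)]
  have "typed (App (lift t) v) (ins 0 M (\<Gamma>1 + G)) (Suc (n1 + i)) A"
    using cons_plus[of "{#}" M \<Gamma>1 G] by (simp add: ins_0)
  from cutI[where P = "typed (App (lift t) v)", OF this 2(4)]
  have "typed (Sub (App (lift t) v) u) (\<Gamma>1 + G + H) (Suc (n1 + i) + j) A"
    using assms by (simp only: typed_Sub_eq_cut occ.simps add_gr_0 simp_thms)
  then show "typed (Sub (App (lift t) v) u) \<Gamma> n A" by (simp only: 1(1,2) 2(1,2) ac_simps add_Suc add_Suc_right)
qed

lemma typed_Sub_Sub:
  assumes "occ 0 v > 0"
  shows "typed (Sub (Sub (ren (ext Suc) t) v) u) = typed (Sub t (Sub v u))"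
proof (intro HOL.ext iffI)
  fix \<Gamma> n A
  assume "typed (Sub (Sub (ren (ext Suc) t) v) u) \<Gamma> n A"
  then obtain \<Gamma>1 \<Gamma>2 n1 n2 M where 1: "\<Gamma> = \<Gamma>1 + \<Gamma>2" "n = n1 + n2" "M \<noteq> {#}"
    "typed (Sub (ren (ext Suc) t) v) (M \<cdot> \<Gamma>1) n1 A" "many (typed u) \<Gamma>2 n2 M" by (rule typed_SubE)
  from 1(4) obtain G H i j N where 2: "M \<cdot> \<Gamma>1 = G + H" "n1 = i + j" "N \<noteq> {#}"
    "typed (ren (ext Suc) t) (N \<cdot> G) i A" "many (typed v) H j N" by (rule typed_SubE)
  from 2(1) obtain M1 M2 \<Delta>1 \<Delta>2 where 3: "G = M1 \<cdot> \<Delta>1" "H = M2 \<cdot> \<Delta>2" "M = M1 + M2" "\<Gamma>1 = \<Delta>1 + \<Delta>2"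
    by (rule cons_eq_plusE)
  have "many (typed v) (ins 0 M \<Delta>2) j N"
    using 2(5) by (rule many_typed_weaken_on) (simp_all add: ins_0 3 split: nat.splits)
  from cutI[where P = "many (typed v)", OF this 1(5)]
  have "many (typed (Sub v u)) (\<Delta>2 + \<Gamma>2) (j + n2) N"
    by (simp only: typed_Sub_eq_cut[OF assms] many_cut)
  moreover have "typed t (N \<cdot> \<Delta>1) i A" using 2(4) by (simp add: 3)
  ultimately have "typed (Sub t (Sub v u)) (\<Delta>1 + (\<Delta>2 + \<Gamma>2)) (i + (j + n2)) A"
    using 2(3) by (intro typed_SubI)
  then show "typed (Sub t (Sub v u)) \<Gamma> n A" by (simp only: 1(1,2) 2(2) 3(4) ac_simps)
next
  fix \<Gamma> n A
  assume "typed (Sub t (Sub v u)) \<Gamma> n A"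
  then obtain \<Gamma>1 \<Gamma>2 n1 n2 N where 1: "\<Gamma> = \<Gamma>1 + \<Gamma>2" "n = n1 + n2" "N \<noteq> {#}"
    "typed t (N \<cdot> \<Gamma>1) n1 A" "cut_rule (many (typed v)) (typed u) 0 \<Gamma>2 n2 N"
    unfolding many_cut[symmetric] typed_Sub_eq_cut[OF assms, symmetric] by (rule typed_SubE)
  from 1(5) obtain G H i j M where 2: "\<Gamma>2 = G + H" "n2 = i + j"
    "many (typed v) (M \<cdot> G) i N" "many (typed u) H j M" unfolding ins_0[symmetric] by (rule cutE)
  have "typed (ren (ext Suc) t) (N \<cdot> {#} \<cdot> \<Gamma>1) n1 A" using 1(4) by simp
  from typed_SubI[OF this 2(3) 1(3)]
  have "typed (Sub (ren (ext Suc) t) v) (ins 0 M (\<Gamma>1 + G)) (n1 + i) A"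
    using cons_plus[of "{#}" M \<Gamma>1 G] by (simp add: ins_0)
  from cutI[where P = "typed (Sub (ren (ext Suc) t) v)", OF this 2(4)]
  have "typed (Sub (Sub (ren (ext Suc) t) v) u) (\<Gamma>1 + G + H) (n1 + i + j) A"
    using assms by (simp only: typed_Sub_eq_cut occ.simps add_gr_0 simp_thms)
  then show "typed (Sub (Sub (ren (ext Suc) t) v) u) \<Gamma> n A" by (simp only: 1(1,2) 2(1,2) ac_simps)
qed

lemma ren_ext_Suc_pred:
  assumes "occ 1 t = 0"
  shows "ren (ext Suc) (ren (\<lambda>i. if i = 0 then 0 else i - 1) t) = t"
proof -
  have "ext Suc (if i = 0 then 0 else i - 1) = i" if "occ i t > 0" for i
  proof (cases i)
    case (Suc j)
    then show ?thesis using that assms by (cases j) auto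
  qed simp
  then show ?thesis unfolding ren_ren by (rule ren_id_on)
qed

lemma obox_ax_typed: "obox_ax t u \<Longrightarrow> typed t = typed u"
proof (induction rule: obox_ax.induct)
  case (ax_perm s t v)
  from lift_lower[OF this] obtain s' where s: "s = lift s'" by (rule that[OF sym])
  show ?case unfolding s lower_lift
  proof (intro HOL.ext iffI)
    fix \<Gamma> n A
    assume "typed (Sub (Sub (ren swap01 t) (lift v)) s') \<Gamma> n A"
    from typed_perm[OF this] show "typed (Sub (Sub t (lift s')) v) \<Gamma> n A"
      by (simp only: ren_swap01_swap01)
  qed (rule typed_perm)
next
  case (ax_lam s t)
  then show ?case using typed_Lam_Sub[of t "lower s"] by (simp only: lift_lower)
next
  case (ax_appl t s v)
  show ?case by (rule typed_App_Sub_left)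
next
  case (ax_appr t v u)
  then show ?case using typed_App_Sub_right[of v "lower t" u] by (simp only: lift_lower)
next
  case (ax_box t v u)
  then show ?case
    using typed_Sub_Sub[of v "ren (\<lambda>i. if i = 0 then 0 else i - 1) t" u] by (simp only: ren_ext_Suc_pred)
qed

text \<open>Invariance is an equality of relations, and \<open>typed\<close> of a compound term is a
  function of \<open>typed\<close> of its parts, so closure under contexts is mere
  rewriting.\<close>

lemma obox_step_typed: "obox_step t u \<Longrightarrow> typed t = typed u"
  by (induction rule: obox_step.induct) (simp_all only: obox_ax_typed typed.simps)

section \<open>Invariance of multiplicities, weight and number of jumps\<close>

definition jmeasure :: "trm \<Rightarrow> (nat \<Rightarrow> nat) \<times> nat \<times> nat" where
  "jmeasure t = ((\<lambda>k. pmult k t), jweight t, jumps t)"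

lemma pmult_box:
  "pmult 0 (ren (ext Suc) t) = pmult 0 t"
  "pmult (Suc 0) (ren (ext Suc) t) = 0"
  "pmult (Suc (Suc k)) (ren (ext Suc) t) = pmult (Suc k) t"
  using pmult_ren[of "ext Suc" "Suc k" t]
  by (auto simp: pmult_ren_notin ext_def split: nat.splits)

lemma obox_ax_jmeasure: "obox_ax t u \<Longrightarrow> jmeasure t = jmeasure u"
proof (induction rule: obox_ax.induct)
  case (ax_perm s t v)
  from lift_lower[OF this] obtain s' where s: "s = lift s'" by (rule that[OF sym])
  show ?case unfolding s lower_lift jmeasure_def by (simp add: fun_eq_iff)
next
  case (ax_lam s t)
  from lift_lower[OF this] obtain s' where s: "s = lift s'" by (rule that[OF sym])
  show ?case unfolding s lower_lift jmeasure_def by (simp add: fun_eq_iff)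
next
  case (ax_appl t s v)
  show ?case unfolding jmeasure_def by (simp add: fun_eq_iff)
next
  case (ax_appr t v u)
  from lift_lower[OF this(1)] obtain t' where t: "t = lift t'" by (rule that[OF sym])
  show ?case unfolding t lower_lift jmeasure_def by (simp add: fun_eq_iff)
next
  case (ax_box t v u)
  then obtain t' where t: "t = ren (ext Suc) t'" "t' = ren (\<lambda>i. if i = 0 then 0 else i - 1) t"
    using ren_ext_Suc_pred[of t] by simp
  \<comment> \<open>Since the variable occurs in \<open>v\<close>, the outer \<open>max\<close> is
    inert and \<open>u\<close> counts \<open>max 1 (pmult 0 t') * pmult 0 v\<close> times on both
    sides. A void jump would count \<open>u\<close> once outside, but once per potential copy of
    \<open>v\<close> inside.\<close>
  have "pmult 0 v > 0" using ax_box by (simp add: pmult_pos_iff)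
  then have "max 1 (max 1 (pmult 0 t') * pmult 0 v) = max 1 (pmult 0 t') * pmult 0 v" "max 1 (pmult 0 v) = pmult 0 v"
    by (simp_all add: Suc_le_eq max_def)
  then show ?case
    unfolding t(2)[symmetric] unfolding t(1) jmeasure_def
    by (simp only: pmult.simps jweight.simps jumps.simps pmult_box jweight_ren jumps_ren)
      (simp add: algebra_simps)
qed

text \<open>The multiplicities belong to the invariant because the multipliers of surrounding jumps
  are read off them; equality of weight and jumps alone would not pass to contexts.\<close>

lemma obox_step_jmeasure: "obox_step t u \<Longrightarrow> jmeasure t = jmeasure u"
  by (induction rule: obox_step.induct) (auto dest!: obox_ax_jmeasure simp: jmeasure_def fun_eq_iff)

lemma obox_eq_invariant:
  assumes "obox_eq t u" "\<And>t u. obox_step t u \<Longrightarrow> f t = f u"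
  shows "f t = f u"
  using assms(1) unfolding obox_eq_def
  by (induction rule: rtranclp_induct) (auto dest: assms(2))



section \<open>Reduction steps\<close>

definition typing_decreases :: "trm \<Rightarrow> trm \<Rightarrow> bool" where
  "typing_decreases t t' \<longleftrightarrow> (\<forall>\<Gamma> n A. typed t \<Gamma> n A \<longrightarrow> 0 < n \<and> typed t' \<Gamma> (n - 1) A)"

definition typing_preserved :: "trm \<Rightarrow> trm \<Rightarrow> bool" where
  "typing_preserved t t' \<longleftrightarrow> (\<forall>\<Gamma> n A. typed t \<Gamma> n A \<longrightarrow> typed t' \<Gamma> n A)"

lemma typing_decreasesD:
  assumes "typing_decreases t t'" "typed t \<Gamma> n A"
  obtains m where "n = Suc m" "typed t' \<Gamma> m A"
proof (rule that[of "n - 1"])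
  have "0 < n" using assms unfolding typing_decreases_def by blast
  then show "n = Suc (n - 1)" by simp
  show "typed t' \<Gamma> (n - 1) A" using assms unfolding typing_decreases_def by blast
qed

lemma typing_decreasesI:
  "(\<And>\<Gamma> n A. typed t \<Gamma> n A \<Longrightarrow> \<exists>m. n = Suc m \<and> typed t' \<Gamma> m A) \<Longrightarrow> typing_decreases t t'"
  unfolding typing_decreases_def by fastforce

text \<open>One member of the nonempty family yields the strict drop, and the others merely keep
  their bounds. This is why an argument has to be typed even if it will be erased: a dB step inside
  it must show in the count.\<close>

lemma typing_decreases_many:
  assumes "typing_decreases u u'" "many (typed u) \<Gamma> n M" "M \<noteq> {#}"
  obtains m where "n = Suc m" "many (typed u') \<Gamma> m M"
proof -
  have weak: "typed u' \<Gamma> n A" if "typed u \<Gamma> n A" for \<Gamma> n A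
  proof -
    from assms(1) that obtain m where "n = Suc m" "typed u' \<Gamma> m A" by (rule typing_decreasesD)
    then show ?thesis using typed_weaken_on[of u' \<Gamma> m A n \<Gamma>] by simp
  qed
  have "\<exists>m. n = Suc m \<and> many (typed u') \<Gamma> m M"
    using assms(2,3)
  proof cases
    case (many_add \<Gamma>1 n1 A \<Delta> m N)
    from assms(1) many_add(4) obtain k where "n1 = Suc k" "typed u' \<Gamma>1 k A" by (rule typing_decreasesD)
    moreover have "many (typed u') \<Delta> m N" using many_add(5) weak by (rule many_mono)
    ultimately show ?thesis using many.many_add[of "typed u'" \<Gamma>1 k A \<Delta> m N] many_add(1-3) by simp
  qed simp
  then show ?thesis using that by blast
qed

section \<open>Closure of both properties under contexts\<close>

lemma typing_decreases_Lam: "typing_decreases t t' \<Longrightarrow> typing_decreases (Lam t) (Lam t')"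
  unfolding typing_decreases_def by auto

lemma typing_decreases_AppL:
  assumes "typing_decreases t t'" shows "typing_decreases (App t u) (App t' u)"
proof (rule typing_decreasesI)
  fix \<Gamma> n A
  assume "typed (App t u) \<Gamma> n A"
  then obtain \<Gamma>1 \<Gamma>2 n1 n2 M where *: "\<Gamma> = \<Gamma>1 + \<Gamma>2" "n = Suc (n1 + n2)" "M \<noteq> {#}"
    "typed t \<Gamma>1 n1 (Arr M A)" "many (typed u) \<Gamma>2 n2 M" by (rule typed_AppE)
  from assms *(4) obtain m where "n1 = Suc m" "typed t' \<Gamma>1 m (Arr M A)" by (rule typing_decreasesD)
  with typed_AppI[OF this(2) *(5,3)] show "\<exists>m. n = Suc m \<and> typed (App t' u) \<Gamma> m A"
    by (simp add: *(1,2))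
qed

lemma typing_decreases_AppR:
  assumes "typing_decreases u u'" shows "typing_decreases (App t u) (App t u')"
proof (rule typing_decreasesI)
  fix \<Gamma> n A
  assume "typed (App t u) \<Gamma> n A"
  then obtain \<Gamma>1 \<Gamma>2 n1 n2 M where *: "\<Gamma> = \<Gamma>1 + \<Gamma>2" "n = Suc (n1 + n2)" "M \<noteq> {#}"
    "typed t \<Gamma>1 n1 (Arr M A)" "many (typed u) \<Gamma>2 n2 M" by (rule typed_AppE)
  from assms *(5,3) obtain m where "n2 = Suc m" "many (typed u') \<Gamma>2 m M" by (rule typing_decreases_many)
  with typed_AppI[OF *(4) this(2) *(3)] show "\<exists>m. n = Suc m \<and> typed (App t u') \<Gamma> m A"
    by (simp add: *(1,2))
qed

lemma typing_decreases_SubL: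
  assumes "typing_decreases t t'" shows "typing_decreases (Sub t u) (Sub t' u)"
proof (rule typing_decreasesI)
  fix \<Gamma> n A
  assume "typed (Sub t u) \<Gamma> n A"
  then obtain \<Gamma>1 \<Gamma>2 n1 n2 M where *: "\<Gamma> = \<Gamma>1 + \<Gamma>2" "n = n1 + n2" "M \<noteq> {#}"
    "typed t (M \<cdot> \<Gamma>1) n1 A" "many (typed u) \<Gamma>2 n2 M" by (rule typed_SubE)
  from assms *(4) obtain m where "n1 = Suc m" "typed t' (M \<cdot> \<Gamma>1) m A" by (rule typing_decreasesD)
  with typed_SubI[OF this(2) *(5,3)] show "\<exists>m. n = Suc m \<and> typed (Sub t' u) \<Gamma> m A"
    by (simp add: *(1,2))
qed

lemma typing_decreases_SubR:
  assumes "typing_decreases u u'" shows "typing_decreases (Sub t u) (Sub t u')"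
proof (rule typing_decreasesI)
  fix \<Gamma> n A
  assume "typed (Sub t u) \<Gamma> n A"
  then obtain \<Gamma>1 \<Gamma>2 n1 n2 M where *: "\<Gamma> = \<Gamma>1 + \<Gamma>2" "n = n1 + n2" "M \<noteq> {#}"
    "typed t (M \<cdot> \<Gamma>1) n1 A" "many (typed u) \<Gamma>2 n2 M" by (rule typed_SubE)
  from assms *(5,3) obtain m where "n2 = Suc m" "many (typed u') \<Gamma>2 m M" by (rule typing_decreases_many)
  with typed_SubI[OF *(4) this(2) *(3)] show "\<exists>m. n = Suc m \<and> typed (Sub t u') \<Gamma> m A"
    by (simp add: *(1,2))
qed

lemma typing_preserved_many:
  "typing_preserved u u' \<Longrightarrow> many (typed u) \<Gamma> n M \<Longrightarrow> many (typed u') \<Gamma> n M"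
  unfolding typing_preserved_def by (erule many_mono) blast

lemma typing_preserved_Lam: "typing_preserved t t' \<Longrightarrow> typing_preserved (Lam t) (Lam t')"
  by (auto simp: typing_preserved_def)

lemma typing_preserved_App:
  assumes "typing_preserved t t'" "typing_preserved u u'"
  shows "typing_preserved (App t u) (App t' u')"
  unfolding typing_preserved_def
proof (intro allI impI, elim typed_AppE, hypsubst)
  fix \<Gamma>1 \<Gamma>2 n1 n2 M A
  assume "M \<noteq> {#}" "typed t \<Gamma>1 n1 (Arr M A)" "many (typed u) \<Gamma>2 n2 M"
  then show "typed (App t' u') (\<Gamma>1 + \<Gamma>2) (Suc (n1 + n2)) A"
    using assms(1) typing_preserved_many[OF assms(2)]
    unfolding typing_preserved_def by (intro typed_AppI) blast+
qed

lemma typing_preserved_Sub: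
  assumes "typing_preserved t t'" "typing_preserved u u'"
  shows "typing_preserved (Sub t u) (Sub t' u')"
  unfolding typing_preserved_def
proof (intro allI impI, elim typed_SubE, hypsubst)
  fix \<Gamma>1 \<Gamma>2 n1 n2 M A
  assume "M \<noteq> {#}" "typed t (M \<cdot> \<Gamma>1) n1 A" "many (typed u) \<Gamma>2 n2 M"
  then show "typed (Sub t' u') (\<Gamma>1 + \<Gamma>2) (n1 + n2) A"
    using assms(1) typing_preserved_many[OF assms(2)]
    unfolding typing_preserved_def by (intro typed_SubI) blast+
qed

lemma typing_preserved_refl: "typing_preserved t t"
  by (simp add: typing_preserved_def)

lemma typing_preserved_subst: "typing_preserved (Sub t u) (subst t 0 u)"
  by (simp add: typing_preserved_def typed_subst_iff cut_of_typed_Sub)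

lemma lift_liftn: "liftn k (lift u) = liftn (Suc k) u"
  by (simp add: liftn_def lift_def ren_ren)

text \<open>The derivations of the argument travel inward through \<open>L\<close>, peeled from its
  outermost jump; each passage lifts \<open>u\<close> once, which accounts for
  \<open>liftn (length L) u\<close>. The application rule itself is gone, so the bound is one below
  that of the redex.\<close>

lemma typed_wrap_redex:
  "typed (wrap L (Lam t)) \<Gamma> n (Arr M A) \<Longrightarrow> many (typed u) \<Delta> m M \<Longrightarrow> M \<noteq> {#} \<Longrightarrow>
   typed (wrap L (Sub t (liftn (length L) u))) (\<Gamma> + \<Delta>) (n + m) A"
proof (induction L arbitrary: \<Gamma> n u \<Delta> m rule: rev_induct)
  case Nil
  have "liftn 0 u = u" by (simp add: liftn_def ren_id_on)
  moreover have "typed t (M \<cdot> \<Gamma>) n A" using Nil(1) by simp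
  ultimately show ?case using typed_SubI[OF _ Nil(2,3)] by (simp only: wrap.simps list.size)
next
  case (snoc v L)
  from snoc.prems(1) obtain \<Gamma>1 \<Gamma>2 n1 n2 N where 1: "\<Gamma> = \<Gamma>1 + \<Gamma>2" "n = n1 + n2" "N \<noteq> {#}"
    "typed (wrap L (Lam t)) (N \<cdot> \<Gamma>1) n1 (Arr M A)" "many (typed v) \<Gamma>2 n2 N"
    unfolding wrap_snoc by (rule typed_SubE)
  from snoc.IH[OF 1(4) many_typed_lift[OF snoc.prems(2)] snoc.prems(3)]
  have "typed (wrap L (Sub t (liftn (Suc (length L)) u))) (N \<cdot> (\<Gamma>1 + \<Delta>)) (n1 + m) A"
    by (simp only: lift_liftn cons_plus[symmetric] add_0_right)
  from typed_SubI[OF this 1(5,3)]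
  have "typed (wrap (L @ [v]) (Sub t (liftn (length (L @ [v])) u))) (\<Gamma>1 + \<Delta> + \<Gamma>2) (n1 + m + n2) A"
    by (simp only: wrap_snoc length_append_singleton)
  then show ?case by (simp only: 1(1,2) ac_simps)
qed

lemma typing_decreases_dB:
  "typing_decreases (App (wrap L (Lam t)) u) (wrap L (Sub t (liftn (length L) u)))"
  by (rule typing_decreasesI) (auto elim!: typed_AppE intro: typed_wrap_redex)

section \<open>Contraction: sharing out the types of a variable\<close>

lemma many_distribute:
  assumes "many P G n N" "x \<noteq> y"
    and "\<And>G n A. P G n A \<Longrightarrow> \<exists>M1 M2. M1 + M2 = G x + G y \<and> Q (G(x := M1, y := M2)) n A"
  shows "\<exists>M1 M2. M1 + M2 = G x + G y \<and> many Q (G(x := M1, y := M2)) n N"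
  using assms(1)
proof (induction rule: many.induct)
  case (many_empty \<Gamma> n)
  show ?case by (intro exI conjI, rule refl, rule many.many_empty)
next
  case (many_add \<Gamma> n A \<Delta> m N)
  from assms(3)[OF many_add.hyps(1)] obtain M1 M2
    where 1: "M1 + M2 = \<Gamma> x + \<Gamma> y" "Q (\<Gamma>(x := M1, y := M2)) n A" by blast
  from many_add.IH obtain N1 N2
    where 2: "N1 + N2 = \<Delta> x + \<Delta> y" "many Q (\<Delta>(x := N1, y := N2)) m N" by blast
  have "(\<Gamma> + \<Delta>)(x := M1 + N1, y := M2 + N2) = \<Gamma>(x := M1, y := M2) + \<Delta>(x := N1, y := N2)"
    by (rule HOL.ext) simp
  then have "many Q ((\<Gamma> + \<Delta>)(x := M1 + N1, y := M2 + N2)) (n + m) (add_mset A N)"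
    using many.many_add[of Q, OF 1(2) 2(2)] by simp
  moreover have "(M1 + N1) + (M2 + N2) = (\<Gamma> + \<Delta>) x + (\<Gamma> + \<Delta>) y"
  proof -
    have "(M1 + N1) + (M2 + N2) = (M1 + M2) + (N1 + N2)" by (simp only: ac_simps)
    also have "\<dots> = (\<Gamma> + \<Delta>) x + (\<Gamma> + \<Delta>) y" unfolding 1(1) 2(1) plus_fun_apply by (simp only: ac_simps)
    finally show ?thesis .
  qed
  ultimately show ?case by blast
qed

text \<open>The renaming acts leaf by leaf and contexts add up through the rules, so the choices
  made at the leaves add up to a redistribution that keeps the sum over \<open>x\<close> and
  \<open>y\<close>.\<close>

lemma typed_distribute:
  "rename_some x y s s' \<Longrightarrow> x \<noteq> y \<Longrightarrow> typed s G n A \<Longrightarrow>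
   \<exists>M1 M2. M1 + M2 = G x + G y \<and> typed s' (G(x := M1, y := M2)) n A"
proof (induction arbitrary: G n A rule: rename_some.induct)
  case (rs_keep x y i)
  then show ?case by (intro exI[of _ "G x"] exI[of _ "G y"]) simp
next
  case (rs_repl x y)
  \<comment> \<open>The two multisets are exchanged as a whole: by weakening the leaf may hold
    further types of \<open>x\<close> and \<open>y\<close>, and these must stay in the sum.\<close>
  then show ?case by (intro exI[of _ "G y"] exI[of _ "G x"]) simp
next
  case (rs_lam x y t t')
  from rs_lam.prems(2) obtain M B where A: "A = Arr M B" "typed t (M \<cdot> G) n B" by auto
  from rs_lam.prems(1) have "Suc x \<noteq> Suc y" by simp
  from rs_lam.IH[OF this A(2)] obtain M1 M2
    where "M1 + M2 = (M \<cdot> G) (Suc x) + (M \<cdot> G) (Suc y)"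
      "typed t' ((M \<cdot> G)(Suc x := M1, Suc y := M2)) n B" by blast
  moreover have "(M \<cdot> G)(Suc x := M1, Suc y := M2) = M \<cdot> (G(x := M1, y := M2))"
    by (rule HOL.ext) (simp split: nat.splits)
  ultimately have "typed (Lam t') (G(x := M1, y := M2)) n A" unfolding typed.simps using A(1) by metis
  moreover have "M1 + M2 = G x + G y" using \<open>M1 + M2 = (M \<cdot> G) (Suc x) + (M \<cdot> G) (Suc y)\<close> by simp
  ultimately show ?case by blast
next
  case (rs_app x y t t' u u')
  from rs_app.prems(2) obtain \<Gamma> \<Delta> n1 n2 M where *: "G = \<Gamma> + \<Delta>" "n = Suc (n1 + n2)" "M \<noteq> {#}"
    "typed t \<Gamma> n1 (Arr M A)" "many (typed u) \<Delta> n2 M" by (rule typed_AppE)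
  from rs_app.IH(1)[OF rs_app.prems(1) *(4)] obtain M1 M2
    where 1: "M1 + M2 = \<Gamma> x + \<Gamma> y" "typed t' (\<Gamma>(x := M1, y := M2)) n1 (Arr M A)" by blast
  from many_distribute[where P = "typed u" and Q = "typed u'", OF *(5) rs_app.prems(1) rs_app.IH(2)[OF rs_app.prems(1)]] obtain N1 N2
    where 2: "N1 + N2 = \<Delta> x + \<Delta> y" "many (typed u') (\<Delta>(x := N1, y := N2)) n2 M" by blast
  have "(\<Gamma> + \<Delta>)(x := M1 + N1, y := M2 + N2) = \<Gamma>(x := M1, y := M2) + \<Delta>(x := N1, y := N2)"
    by (rule HOL.ext) simp
  with typed_AppI[OF 1(2) 2(2) *(3)]
  have "typed (App t' u') (G(x := M1 + N1, y := M2 + N2)) n A" by (simp only: *(1,2))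
  moreover have "(M1 + N1) + (M2 + N2) = G x + G y"
  proof -
    have "(M1 + N1) + (M2 + N2) = (M1 + M2) + (N1 + N2)" by (simp only: ac_simps)
    also have "\<dots> = G x + G y" unfolding 1(1) 2(1) *(1) plus_fun_apply by (simp only: ac_simps)
    finally show ?thesis .
  qed
  ultimately show ?case by blast
next
  case (rs_sub x y t t' u u')
  from rs_sub.prems(2) obtain \<Gamma> \<Delta> n1 n2 M where *: "G = \<Gamma> + \<Delta>" "n = n1 + n2" "M \<noteq> {#}"
    "typed t (M \<cdot> \<Gamma>) n1 A" "many (typed u) \<Delta> n2 M" by (rule typed_SubE)
  from rs_sub.prems(1) have "Suc x \<noteq> Suc y" by simp
  from rs_sub.IH(1)[OF this *(4)] obtain M1 M2
    where 1: "M1 + M2 = (M \<cdot> \<Gamma>) (Suc x) + (M \<cdot> \<Gamma>) (Suc y)"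
      "typed t' ((M \<cdot> \<Gamma>)(Suc x := M1, Suc y := M2)) n1 A" by blast
  from many_distribute[where P = "typed u" and Q = "typed u'", OF *(5) rs_sub.prems(1) rs_sub.IH(2)[OF rs_sub.prems(1)]] obtain N1 N2
    where 2: "N1 + N2 = \<Delta> x + \<Delta> y" "many (typed u') (\<Delta>(x := N1, y := N2)) n2 M" by blast
  have "(M \<cdot> \<Gamma>)(Suc x := M1, Suc y := M2) = M \<cdot> (\<Gamma>(x := M1, y := M2))"
    by (rule HOL.ext) (simp split: nat.splits)
  with 1(2) have "typed t' (M \<cdot> (\<Gamma>(x := M1, y := M2))) n1 A" by simp
  from typed_SubI[OF this 2(2) *(3)]
  have "typed (Sub t' u') (\<Gamma>(x := M1, y := M2) + \<Delta>(x := N1, y := N2)) n A" by (simp only: *(2))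
  moreover have "(\<Gamma> + \<Delta>)(x := M1 + N1, y := M2 + N2) = \<Gamma>(x := M1, y := M2) + \<Delta>(x := N1, y := N2)"
    by (rule HOL.ext) simp
  ultimately have "typed (Sub t' u') (G(x := M1 + N1, y := M2 + N2)) n A" by (simp only: *(1))
  moreover have "(M1 + N1) + (M2 + N2) = G x + G y"
  proof -
    have "(M1 + N1) + (M2 + N2) = (M1 + M2) + (N1 + N2)" by (simp only: ac_simps)
    also have "\<dots> = G x + G y" unfolding 1(1) 2(1) *(1) plus_fun_apply old.nat.case by (simp only: ac_simps)
    finally show ?thesis .
  qed
  ultimately show ?case by blast
qed

text \<open>The way \<open>t'\<close> uses its two variables splits the multiset in two. Both parts
  are nonempty because both variables occur, so both new jumps are typable, and the derivations of
  \<open>u\<close> are divided rather than copied, which keeps the bound.\<close>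

lemma typing_preserved_contract:
  assumes "rename_some 0 1 (ren (ext Suc) t) t'" "occ 0 t' \<ge> 1" "occ 1 t' \<ge> 1"
  shows "typing_preserved (Sub t u) (Sub (Sub t' (lift u)) u)"
  unfolding typing_preserved_def
proof (intro allI impI)
  fix \<Gamma> n A
  assume "typed (Sub t u) \<Gamma> n A"
  then obtain \<Gamma>1 \<Gamma>2 n1 n2 M where 1: "\<Gamma> = \<Gamma>1 + \<Gamma>2" "n = n1 + n2"
    "typed t (M \<cdot> \<Gamma>1) n1 A" "many (typed u) \<Gamma>2 n2 M" by (rule typed_SubE)
  \<comment> \<open>The fresh variable starts with no types, so all it receives comes out of
    \<open>M\<close>.\<close>
  from 1(3) have "typed (ren (ext Suc) t) (M \<cdot> {#} \<cdot> \<Gamma>1) n1 A" by simp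
  from typed_distribute[OF assms(1) zero_neq_one this] obtain M1 M2
    where 2: "M1 + M2 = (M \<cdot> {#} \<cdot> \<Gamma>1) 0 + (M \<cdot> {#} \<cdot> \<Gamma>1) 1"
      "typed t' ((M \<cdot> {#} \<cdot> \<Gamma>1)(0 := M1, 1 := M2)) n1 A" by blast
  from 2(1) have M: "M = M1 + M2" by simp
  have "(M \<cdot> {#} \<cdot> \<Gamma>1)(0 := M1, 1 := M2) = M1 \<cdot> M2 \<cdot> \<Gamma>1"
    by (rule HOL.ext) (auto split: nat.splits)
  with 2(2) have t': "typed t' (M1 \<cdot> M2 \<cdot> \<Gamma>1) n1 A" by simp
  then have ne: "M1 \<noteq> {#}" "M2 \<noteq> {#}"
    using typed_occ_nonempty[OF t', of 0] typed_occ_nonempty[OF t', of 1] assms(2,3) by simp_all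
  from 1(4)[unfolded M] obtain \<Delta>1 \<Delta>2 m1 m2 where 3: "\<Gamma>2 = \<Delta>1 + \<Delta>2" "n2 = m1 + m2"
    "many (typed u) \<Delta>1 m1 M1" "many (typed u) \<Delta>2 m2 M2" by (rule many_split)
  from typed_SubI[OF t' many_typed_lift[OF 3(3)] ne(1)]
  have "typed (Sub t' (lift u)) (M2 \<cdot> (\<Gamma>1 + \<Delta>1)) (n1 + m1) A"
    using cons_plus[of M2 "{#}" \<Gamma>1 \<Delta>1] by simp
  from typed_SubI[OF this 3(4) ne(2)] show "typed (Sub (Sub t' (lift u)) u) \<Gamma> n A"
    by (simp only: 1(1,2) 3(1,2) ac_simps)
qed

text \<open>The alternative reflects the lexicographic order: a dB step lowers the count at whatever
  depth it takes place, and only the steps that merely preserve typings have to decrease in the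
  sense of \<open>jless\<close>.\<close>

lemma lj_progress:
  "lj t t' \<Longrightarrow> typing_decreases t t' \<or> typing_preserved t t' \<and> jless t' t"
proof (induction rule: lj.induct)
  case (lj_dB L t u)
  show ?case using typing_decreases_dB by blast
next
  case (lj_c t t'' u)
  then show ?case using typing_preserved_contract jless_contract by blast
next
  case lj_w
  show ?case using typing_preserved_subst jless_subst by blast
next
  case lj_d
  show ?case using typing_preserved_subst jless_subst by blast
next
  case lj_lam
  then show ?case using typing_decreases_Lam typing_preserved_Lam jless_Lam by blast
next
  case (lj_appl t t' u)
  then show ?case
    using typing_decreases_AppL typing_preserved_App[OF _ typing_preserved_refl] jless_AppL by blast
next
  case (lj_appr u u' t)
  then show ?case
    using typing_decreases_AppR typing_preserved_App[OF typing_preserved_refl] jless_AppR by blast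
next
  case (lj_subl t t' u)
  then show ?case
    using typing_decreases_SubL typing_preserved_Sub[OF _ typing_preserved_refl] jless_SubL by blast
next
  case (lj_subr u u' t)
  then show ?case
    using typing_decreases_SubR typing_preserved_Sub[OF typing_preserved_refl] jless_SubR by blast
qed

theorem typed_imp_SN: "typed t \<Gamma> n A \<Longrightarrow> SN lj_obox t"
proof (induction "(n, jweight t, jweight t - jumps t)" arbitrary: t n
    rule: wf_induct_rule[OF wf_lex_prod[OF wf_less_than wf_lex_prod[OF wf_less_than wf_less_than]]])
  case (1 t n)
  show ?case unfolding SN_def
  proof (rule accpI)
    fix v assume "lj_obox t v"
    then obtain t' v' where *: "obox_eq t t'" "lj t' v'" "obox_eq v' v" unfolding lj_obox_def by blast
    have jm: "jmeasure t = jmeasure t'" "jmeasure v' = jmeasure v"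
      using obox_eq_invariant[OF *(1)] obox_eq_invariant[OF *(3)] obox_step_jmeasure by blast+
    have ty: "typed t = typed t'" "typed v' = typed v"
      using obox_eq_invariant[OF *(1)] obox_eq_invariant[OF *(3)] obox_step_typed by blast+
    from lj_progress[OF *(2)]
    have "\<exists>m. typed v \<Gamma> m A \<and> ((m, jweight v, jweight v - jumps v), (n, jweight t, jweight t - jumps t))
        \<in> less_than <*lex*> (less_than <*lex*> less_than)"
    proof
      assume "typing_decreases t' v'"
      moreover have "typed t' \<Gamma> n A" using 1(2) ty by simp
      ultimately obtain m where "n = Suc m" "typed v' \<Gamma> m A" by (rule typing_decreasesD)
      then show ?thesis using ty by auto
    next
      assume "typing_preserved t' v' \<and> jless v' t'"
      then have "typed v \<Gamma> n A" "jless v' t'" using 1(2) ty unfolding typing_preserved_def by auto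
      moreover from this have "jweight v < jweight t \<or> jweight v = jweight t \<and> jumps t < jumps v"
        using jm unfolding jless_def jmeasure_def by simp
      \<comment> \<open>At equal weight, more jumps lower the truncated difference only because the
        number of jumps stays below the weight; otherwise both differences could be 0.\<close>
      ultimately show ?thesis using jumps_le_jweight[of v] by (intro exI[of _ n]) auto
    qed
    then obtain m where m: "typed v \<Gamma> m A" "((m, jweight v, jweight v - jumps v), (n, jweight t, jweight t - jumps t))
        \<in> less_than <*lex*> (less_than <*lex*> less_than)" by blast
    from 1(1)[OF m(2,1)] show "Wellfounded.accp (\<lambda>y x. lj_obox x y) v" unfolding SN_def .
  qed
qed


section \<open>Strongly normalizing lambda-terms are typable\<close>

definition typable :: "trm \<Rightarrow> bool" where
  "typable t \<longleftrightarrow> (\<exists>\<Gamma> n A. typed t \<Gamma> n A)"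

text \<open>The arguments are required to be typable, which leaves the type of the whole free to
  choose: the head variable takes one arrow with singleton domain per argument.\<close>

inductive neutral :: "trm \<Rightarrow> bool" where
  "neutral (Var i)"
| "neutral t \<Longrightarrow> typable u \<Longrightarrow> neutral (App t u)"

text \<open>The condition \<open>typable u\<close> is what expansion needs when the contracted redex
  erases its argument: the application still has to type it.\<close>

inductive whr :: "trm \<Rightarrow> trm \<Rightarrow> bool" where
  "typable u \<Longrightarrow> whr (App (Lam t) u) (subst t 0 u)"
| "whr t t' \<Longrightarrow> whr (App t u) (App t' u)"

text \<open>Subterms below a binder are taken as open terms, without adjusting indices; this is
  harmless because \<open>typable\<close> leaves the context free.\<close>

inductive subterm :: "trm \<Rightarrow> trm \<Rightarrow> bool" where
  subterm_refl: "subterm t t"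
| subterm_Lam: "subterm s t \<Longrightarrow> subterm s (Lam t)"
| subterm_AppL: "subterm s t \<Longrightarrow> subterm s (App t u)"
| subterm_AppR: "subterm s u \<Longrightarrow> subterm s (App t u)"

lemma neutral_typed: "neutral t \<Longrightarrow> \<exists>\<Gamma> n. typed t \<Gamma> n A"
proof (induction arbitrary: A rule: neutral.induct)
  case (1 i)
  show ?case by (intro exI[of _ "\<lambda>_. {#A#}"]) simp
next
  case (2 t u)
  from 2(2) obtain \<Delta> m B where "typed u \<Delta> m B" unfolding typable_def by blast
  then have "many (typed u) \<Delta> m {#B#}" by (rule many_single)
  moreover from 2(3) obtain \<Gamma> n where "typed t \<Gamma> n (Arr {#B#} A)" by blast
  ultimately show ?case using typed_AppI[of t \<Gamma> n "{#B#}" A u] by fastforce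
qed

lemma typable_Lam: "typable t \<Longrightarrow> typable (Lam t)"
  unfolding typable_def typed.simps by (metis cons_eta)

lemma whr_typed: "whr t t' \<Longrightarrow> typed t' \<Gamma> n A \<Longrightarrow> \<exists>\<Delta> m. typed t \<Delta> m A"
proof (induction arbitrary: \<Gamma> n A rule: whr.induct)
  case (1 u t)
  from 1(2) obtain \<Gamma>1 \<Gamma>2 n1 n2 M where t: "typed t (M \<cdot> \<Gamma>1) n1 A" and M: "many (typed u) \<Gamma>2 n2 M"
    unfolding typed_subst_iff by (elim cutE) (simp add: ins_0)
  from 1(1) obtain \<Delta> m B where "typed u \<Delta> m B" unfolding typable_def by blast
  \<comment> \<open>The type \<open>B\<close> is added so that the multiset is nonempty even if
    \<open>u\<close> is erased; for \<open>t\<close> the additional assumption is a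
    weakening.\<close>
  then have u: "many (typed u) (\<Delta> + \<Gamma>2) (m + n2) (add_mset B M)" using M by (rule many_add)
  have "typed (Lam t) \<Gamma>1 n1 (Arr (add_mset B M) A)"
    using typed_weaken_cons[OF t, of "add_mset B M"] by simp
  from typed_AppI[OF this u add_mset_not_empty] show ?case by blast
next
  case (2 t t' u)
  from 2(3) obtain \<Gamma>1 \<Gamma>2 n1 n2 M where *: "M \<noteq> {#}"
    "typed t' \<Gamma>1 n1 (Arr M A)" "many (typed u) \<Gamma>2 n2 M" by (rule typed_AppE)
  from 2(2)[OF *(2)] obtain \<Delta> m where "typed t \<Delta> m (Arr M A)" by blast
  from typed_AppI[OF this *(3,1)] show ?case by blast
qed

lemma whr_imp_beta: "whr t t' \<Longrightarrow> beta t t'"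
  by (induction rule: whr.induct) (auto intro: beta.intros)

lemma subterm_trans: "subterm s t \<Longrightarrow> subterm r s \<Longrightarrow> subterm r t"
  by (induction rule: subterm.induct) (auto intro: subterm.intros)

lemma subterm_beta: "subterm s t \<Longrightarrow> beta s s' \<Longrightarrow> \<exists>t'. beta t t' \<and> subterm s' t'"
proof (induction rule: subterm.induct)
  case (subterm_refl t)
  then show ?case using subterm.subterm_refl by blast
qed (metis beta.intros subterm.intros)+

lemma subterm_is_lambda: "subterm s t \<Longrightarrow> is_lambda t \<Longrightarrow> is_lambda s"
  by (induction rule: subterm.induct) auto

lemma is_lambda_ren: "is_lambda (ren f t) = is_lambda t"
  by (induction t arbitrary: f) auto

lemma is_lambda_subst: "is_lambda t \<Longrightarrow> is_lambda u \<Longrightarrow> is_lambda (subst t k u)"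
  by (induction t arbitrary: k u) (auto simp: lift_def is_lambda_ren)

lemma is_lambda_beta: "beta t t' \<Longrightarrow> is_lambda t \<Longrightarrow> is_lambda t'"
  by (induction rule: beta.induct) (auto simp: is_lambda_subst)

text \<open>Typability and the shape of the term are proved together: an application is either
  neutral, hence typable outright, or weak head reducible, hence typable by expansion from a reduct
  covered by the hypothesis. The hypothesis ranges over all subterms because arguments and bodies
  are treated recursively.\<close>

lemma typable_of_reducts:
  assumes "is_lambda t" "\<And>s s'. subterm s t \<Longrightarrow> beta s s' \<Longrightarrow> typable s'"
  shows "typable t \<and> (neutral t \<or> (\<exists>s. t = Lam s) \<or> (\<exists>t'. whr t t'))"
  using assms
proof (induction t)
  case (Var i)
  then show ?case using neutral_typed neutral.intros(1) unfolding typable_def by blast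
next
  case (Lam t)
  have "typable t" using Lam.IH Lam.prems(1) Lam.prems(2)[OF subterm_Lam] by simp
  then show ?case using typable_Lam by simp
next
  case (App t u)
  have t: "neutral t \<or> (\<exists>s. t = Lam s) \<or> (\<exists>t'. whr t t')" and u: "typable u"
    using App.IH App.prems(1) App.prems(2)[OF subterm_AppL] App.prems(2)[OF subterm_AppR] by simp_all
  then have cases: "neutral (App t u) \<or> (\<exists>t'. whr (App t u) t')"
    using neutral.intros(2) whr.intros by blast
  moreover have "typable (App t u)"
    using cases
  proof
    assume "neutral (App t u)"
    then show ?thesis using neutral_typed unfolding typable_def by blast
  next
    assume "\<exists>t'. whr (App t u) t'"
    then obtain t' where t': "whr (App t u) t'" by blast
    from App.prems(2)[OF subterm_refl whr_imp_beta[OF t']] show ?thesis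
      using whr_typed[OF t'] unfolding typable_def by blast
  qed
  ultimately show ?case by blast
qed simp

text \<open>The induction has to include subterms: a reduct of a subterm of \<open>t\<close> need
  not be a reduct of \<open>t\<close>, but it is a subterm of one, and so the induction hypothesis
  covers it.\<close>

lemma SN_beta_imp_typable:
  assumes "SN beta t" "is_lambda t" shows "typable t"
proof -
  have "subterm s t \<Longrightarrow> typable s" for s
    using assms unfolding SN_def
  proof (induction arbitrary: s rule: accp.induct)
    case (accI t)
    have "typable r'" if "subterm r s" "beta r r'" for r r'
    proof -
      from subterm_beta[OF subterm_trans[OF accI.prems(1) that(1)] that(2)]
      obtain t' where "beta t t'" "subterm r' t'" by blast
      then show ?thesis using accI.IH[of t' r'] is_lambda_beta[OF _ accI.prems(2)] by blast
    qed
    then show ?case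
      using typable_of_reducts[OF subterm_is_lambda[OF accI.prems]] by blast
  qed
  then show ?thesis using subterm_refl by blast
qed

theorem theorem48:
  assumes "is_lambda t" and "SN beta t"
  shows "SN lj_obox t"
  using SN_beta_imp_typable[OF assms(2,1)] typed_imp_SN unfolding typable_def by blast

end
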